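(* The function $\zeta_2(s_1,s_2,s_3,s_4,s_5,s_6;G_2)$ can be continued meromorphically to the whole space $\mathbb{C}^6$, and its possible singularities are located on the subsets of $\mathbb{C}^6$ defined by one of the equations: \begin{align*} & s_1+s_3+s_4+s_5+s_6=1-l\quad (l\in \mathbb{N}_0),\\ & s_2+s_3+s_4+s_5+s_6=1-l\quad (l\in \mathbb{N}_0),\\ & s_1+s_2+s_3+s_4+s_5+s_6=2. \end{align*}
   Context: $\mathbb{N}_0=\{0,1,2,\dots\}$. The zeta-function of the root system of type $G_2$ is defined, for $(s_1,\dots,s_6)\in\mathbb{C}^6$ in the region of absolute convergence (in particular when all $\Re s_j$ are sufficiently large), by $$\zeta_2(s_1,s_2,s_3,s_4,s_5,s_6;G_2)=\sum_{m=1}^\infty\sum_{n=1}^\infty\frac{1}{m^{s_1}n^{s_2}(m+n)^{s_3}(m+2n)^{s_4}(m+3n)^{s_5}(2m+3n)^{s_6}}.$$ *)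

theory Defs
  imports "HOL-Analysis.Analysis"
begin

text \<open>
  Functions of several complex variables. The derivative supplied by \<open>has_derivative\<close> is only
  real-linear, so complex homogeneity is required explicitly.
\<close>

definition mv_holomorphic_on :: "(complex ^ 'n \<Rightarrow> complex) \<Rightarrow> (complex ^ 'n) set \<Rightarrow> bool" where
  "mv_holomorphic_on f U \<longleftrightarrow> open U \<and>
     (\<forall>z\<in>U. \<exists>D. (f has_derivative D) (at z) \<and> (\<forall>c v. D (c *s v) = c * D v))"

text \<open>
  Locally a quotient \<open>g / h\<close> of holomorphic functions with \<open>h\<close> not identically zero on a connected
  neighbourhood. The values of \<open>f\<close> at zeros of \<open>h\<close> (points of indeterminacy and poles) are
  unconstrained.
\<close>

definition mv_meromorphic_on :: "(complex ^ 'n \<Rightarrow> complex) \<Rightarrow> (complex ^ 'n) set \<Rightarrow> bool" where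
  "mv_meromorphic_on f \<Omega> \<longleftrightarrow> open \<Omega> \<and>
     (\<forall>p\<in>\<Omega>. \<exists>U g h. p \<in> U \<and> U \<subseteq> \<Omega> \<and> connected U \<and>
        mv_holomorphic_on g U \<and> mv_holomorphic_on h U \<and> (\<exists>z\<in>U. h z \<noteq> 0) \<and>
        (\<forall>z\<in>U. h z \<noteq> 0 \<longrightarrow> f z = g z / h z))"

definition mv_singularities :: "(complex ^ 'n \<Rightarrow> complex) \<Rightarrow> (complex ^ 'n) set" where
  "mv_singularities f = {p. \<not> (\<exists>U. p \<in> U \<and> mv_holomorphic_on f U)}"

text \<open>
  The variables are the six components of a vector in \<open>complex ^ 6\<close>; in the index type \<open>6\<close> the
  numeral \<open>6\<close> denotes the same element as \<open>0\<close>, so the indices \<open>1, ..., 6\<close> are pairwise distinct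
  and exhaust the type.
\<close>

definition G2_term :: "complex ^ 6 \<Rightarrow> nat \<Rightarrow> nat \<Rightarrow> complex" where
  "G2_term s m n =
     1 / (of_nat m powr (s $ 1) * of_nat n powr (s $ 2) * of_nat (m + n) powr (s $ 3) *
          of_nat (m + 2 * n) powr (s $ 4) * of_nat (m + 3 * n) powr (s $ 5) *
          of_nat (2 * m + 3 * n) powr (s $ 6))"

definition G2_abs_conv :: "(complex ^ 6) set" where
  "G2_abs_conv = {s. (\<lambda>(m, n). norm (G2_term s m n)) summable_on ({1..} \<times> {1..})}"

text \<open>Only meaningful on \<open>G2_abs_conv\<close>; elsewhere \<open>infsum\<close> returns a default value.\<close>

definition zeta_G2 :: "complex ^ 6 \<Rightarrow> complex" where
  "zeta_G2 s = (\<Sum>\<^sub>\<infinity>(m, n)\<in>{1..} \<times> {1..}. G2_term s m n)"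

end

theory Submission
  imports Defs "HOL-Complex_Analysis.Conformal_Mappings"
begin

text \<open>
  For linear forms \<open>L\<^sub>j = A\<^sub>j x + B\<^sub>j y\<close>, among them \<open>x\<close> and \<open>y\<close>, put
  \<open>h\<^sub>s = \<Prod>\<^sub>j L\<^sub>j powr (- s\<^sub>j)\<close>. Euler--Maclaurin summation of first order in both variables turns
  the double series into integrals of \<open>h\<^sub>s\<close> and its derivatives against \<open>1\<close> or the sawtooth
  function in each variable. A sawtooth factor is integrated by parts against the periodic Bernoulli
  functions, which improves the decay and creates no poles. Against a factor \<open>1\<close> in \<open>x\<close>, integrating
  \<open>\<partial>\<^sub>x (x h\<^sub>s)\<close> expresses the integral times \<open>\<Sum>\<^sub>j s\<^sub>j - 1\<close> (the sum over the forms containing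
  \<open>x\<close>), through a one-dimensional integral and integrals converging in a larger region; the same
  holds for \<open>y\<close>. If both factors are \<open>1\<close>, Euler's identity for the homogeneous function \<open>h\<^sub>s\<close> reduces
  everything to one-dimensional integrals divided by \<open>\<Sum>\<^sub>j s\<^sub>j - 2\<close>; no other pole of this kind
  arises. All relations hold in the full region of absolute convergence, and the continuations to
  larger and larger regions agree by the identity theorem on complex lines.
\<close>

section \<open>Holomorphic functions of several variables\<close>

text \<open>The obstacle is to reach all of \<open>complex ^ 'n\<close> with only the stated
  hyperplanes. Progress is measured by the three counters of \<open>region\<close>, one for each
  linear form of s in the theorem. Write e_j for \<open>unit_shift j\<close>. A point or sawtooth
  weight in x leads to shifts that raise the counters of the x-sum and of the total; the weight 1 in
  x leads to shifts e_j - e_k, which raise only the counter of the x-sum and cost a division. A pair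
  of weights that are not both 1 is therefore continued by raising the total through a variable with
  non-constant weight, and only then dividing in the other variable if its weight is 1. The pair of
  two constant weights offers no such variable. For it Euler's identity is applied once, where the
  integrals converge, and only its right-hand side is continued; hence the total meets the single
  value 2 and not all values 2 - l. Continuations are kept as local quotients whose denominators
  vanish only on the polar set, so that no list of the divisions has to be carried along.\<close>

definition mv_differentiable :: "(complex ^ 'n \<Rightarrow> complex) \<Rightarrow> complex ^ 'n \<Rightarrow> bool" where
  "mv_differentiable f z \<longleftrightarrow>
     (\<exists>D. (f has_derivative D) (at z) \<and> (\<forall>c v. D (c *s v) = c * D v))"

lemma mv_holomorphic_on_iff:
  "mv_holomorphic_on f U \<longleftrightarrow> open U \<and> (\<forall>z\<in>U. mv_differentiable f z)"
  unfolding mv_holomorphic_on_def mv_differentiable_def ..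

lemma mv_holomorphic_on_subset:
  "mv_holomorphic_on f U \<Longrightarrow> V \<subseteq> U \<Longrightarrow> open V \<Longrightarrow> mv_holomorphic_on f V"
  by (auto simp: mv_holomorphic_on_iff)

lemma mv_differentiable_const [simp]: "mv_differentiable (\<lambda>s. c) z"
  unfolding mv_differentiable_def by (intro exI[of _ "\<lambda>_. 0"]) auto

lemma mv_differentiable_nth [simp]: "mv_differentiable (\<lambda>s. s $ j) z"
  unfolding mv_differentiable_def
  by (intro exI[of _ "\<lambda>v. v $ j"] conjI) (auto intro: bounded_linear_imp_has_derivative bounded_linear_vec_nth)

lemma mv_differentiable_add:
  assumes "mv_differentiable f z" "mv_differentiable g z"
  shows "mv_differentiable (\<lambda>s. f s + g s) z"
proof -
  from assms obtain D E where D: "(f has_derivative D) (at z)" "\<forall>c v. D (c *s v) = c * D v"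
    and E: "(g has_derivative E) (at z)" "\<forall>c v. E (c *s v) = c * E v"
    unfolding mv_differentiable_def by blast
  show ?thesis unfolding mv_differentiable_def
    using D E by (intro exI[of _ "\<lambda>v. D v + E v"] conjI has_derivative_add) (auto simp: algebra_simps)
qed

lemma mv_differentiable_mult:
  assumes "mv_differentiable f z" "mv_differentiable g z"
  shows "mv_differentiable (\<lambda>s. f s * g s) z"
proof -
  from assms obtain D E where D: "(f has_derivative D) (at z)" "\<forall>c v. D (c *s v) = c * D v"
    and E: "(g has_derivative E) (at z)" "\<forall>c v. E (c *s v) = c * E v"
    unfolding mv_differentiable_def by blast
  show ?thesis unfolding mv_differentiable_def
    using D E by (intro exI[of _ "\<lambda>v. f z * E v + D v * g z"] conjI has_derivative_mult)
      (auto simp: algebra_simps)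
qed

lemma mv_differentiable_uminus:
  "mv_differentiable f z \<Longrightarrow> mv_differentiable (\<lambda>s. - f s) z"
  using mv_differentiable_mult[of "\<lambda>_. -1" z f] by simp

lemma mv_differentiable_diff:
  assumes "mv_differentiable f z" "mv_differentiable g z"
  shows "mv_differentiable (\<lambda>s. f s - g s) z"
  using mv_differentiable_add[OF assms(1) mv_differentiable_uminus[OF assms(2)]] by simp

lemma mv_differentiable_sum:
  "(\<And>j. j \<in> J \<Longrightarrow> mv_differentiable (f j) z) \<Longrightarrow> mv_differentiable (\<lambda>s. \<Sum>j\<in>J. f j s) z"
  by (induction J rule: infinite_finite_induct) (auto intro: mv_differentiable_add)

lemma mv_differentiable_prod:
  "(\<And>j. j \<in> J \<Longrightarrow> mv_differentiable (f j) z) \<Longrightarrow> mv_differentiable (\<lambda>s. \<Prod>j\<in>J. f j s) z"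
  by (induction J rule: infinite_finite_induct) (auto intro: mv_differentiable_mult)

lemma mv_differentiable_inverse:
  assumes "mv_differentiable f z" "f z \<noteq> 0"
  shows "mv_differentiable (\<lambda>s. inverse (f s)) z"
proof -
  from assms obtain D where D: "(f has_derivative D) (at z)" "\<forall>c v. D (c *s v) = c * D v"
    unfolding mv_differentiable_def by blast
  show ?thesis unfolding mv_differentiable_def
    using Deriv.has_derivative_inverse[OF assms(2) D(1)] D(2)
    by (intro exI[of _ "\<lambda>v. - (inverse (f z) * D v * inverse (f z))"] conjI) auto
qed

lemma mv_differentiable_divide:
  assumes "mv_differentiable f z" "mv_differentiable g z" "g z \<noteq> 0"
  shows "mv_differentiable (\<lambda>s. f s / g s) z"
  using mv_differentiable_mult[OF assms(1) mv_differentiable_inverse[OF assms(2,3)]]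
  by (simp add: divide_inverse)

lemma mv_differentiable_shift:
  assumes "mv_differentiable f (z + v)"
  shows "mv_differentiable (\<lambda>s. f (s + v)) z"
proof -
  from assms obtain D where D: "(f has_derivative D) (at (z + v))" "\<forall>c v. D (c *s v) = c * D v"
    unfolding mv_differentiable_def by blast
  have "((\<lambda>s. f (s + v)) has_derivative (\<lambda>x. D x)) (at z)"
    by (rule has_derivative_compose[of "\<lambda>s. s + v" "\<lambda>x. x", OF _ D(1)]) (auto intro!: derivative_eq_intros)
  thus ?thesis using D(2) unfolding mv_differentiable_def by blast
qed

lemma mv_differentiable_cong:
  assumes "mv_differentiable f z" "open U" "z \<in> U" "\<And>s. s \<in> U \<Longrightarrow> f s = g s"
  shows "mv_differentiable g z"
  using assms has_derivative_transform_within_open[of f _ z UNIV U g]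
  unfolding mv_differentiable_def by blast

lemma mv_differentiable_continuous: "mv_differentiable f z \<Longrightarrow> isCont f z"
  unfolding mv_differentiable_def using has_derivative_continuous by blast

text \<open>Complex homogeneity of the derivative turns the restriction to a complex line into a
  holomorphic function of one variable, to which the classical identity theorem applies.\<close>

lemma mv_differentiable_line:
  assumes "mv_differentiable f (z + t *s v)"
  shows "(\<lambda>t. f (z + t *s v)) field_differentiable at t"
proof -
  from assms obtain D where D: "(f has_derivative D) (at (z + t *s v))" "\<forall>c v. D (c *s v) = c * D v"
    unfolding mv_differentiable_def by blast
  have "bounded_linear (\<lambda>t::complex. t *s v)"
    by (intro linear_conv_bounded_linear[THEN iffD1] linearI) (auto simp: vec_eq_iff algebra_simps)
  hence "((\<lambda>t. z + t *s v) has_derivative (\<lambda>t. t *s v)) (at t)"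
    by (auto intro!: derivative_eq_intros bounded_linear_imp_has_derivative)
  from has_derivative_compose[OF this D(1)]
  have "((\<lambda>t. f (z + t *s v)) has_derivative (\<lambda>x. D v * x)) (at t)"
    using D(2) by (simp add: mult.commute)
  thus ?thesis unfolding field_differentiable_def has_field_derivative_def by blast
qed

section \<open>Integrals of exponentials depending on a parameter\<close>

lemma norm_exp_minus_one_minus_le:
  fixes z :: complex
  shows "norm (exp z - 1 - z) \<le> (norm z)\<^sup>2 * exp (norm z)"
proof -
  have "norm (exp z - 1 - z) \<le> exp \<bar>Re z\<bar> * norm z ^ 2 / fact 1"
    using Taylor_exp[of z 1] by (simp add: algebra_simps power2_eq_square numeral_2_eq_2)
  also have "exp \<bar>Re z\<bar> * norm z ^ 2 \<le> exp (norm z) * norm z ^ 2"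
    by (intro mult_right_mono) (auto simp: abs_Re_le_cmod)
  finally show ?thesis by (simp add: mult.commute)
qed

text \<open>The margin \<open>e\<close> dominates the quadratic remainder of the exponential series.\<close>

lemma mv_differentiable_integral_exp:
  fixes w :: "'a \<Rightarrow> real" and l :: "'n::finite \<Rightarrow> 'a \<Rightarrow> real" and s :: "complex ^ 'n"
  assumes [measurable]: "w \<in> borel_measurable M" "\<And>j. l j \<in> borel_measurable M"
  assumes e: "e > 0"
    and int: "integrable M (\<lambda>x. w x * exp (- (\<Sum>j\<in>UNIV. Re (s $ j) * l j x) + e * (\<Sum>j\<in>UNIV. \<bar>l j x\<bar>)))"
  shows "mv_differentiable (\<lambda>s. LINT x|M. w x *\<^sub>R exp (- (\<Sum>j\<in>UNIV. s $ j * l j x))) s"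
proof -
  define \<Lambda> where "\<Lambda> x = (\<Sum>j\<in>UNIV. \<bar>l j x\<bar>)" for x
  define E where "E s x = w x *\<^sub>R exp (- (\<Sum>j\<in>UNIV. s $ j * complex_of_real (l j x)))" for s x
  define G where "G x = w x * exp (- (\<Sum>j\<in>UNIV. Re (s $ j) * l j x) + e * \<Lambda> x)" for x
  define dot where "dot v x = (\<Sum>j\<in>UNIV. v $ j * complex_of_real (l j x))" for v x
  define D where "D v = (LINT x|M. - dot v x * E s x)" for v
  have [measurable]: "E t \<in> borel_measurable M" "dot t \<in> borel_measurable M" for t
    unfolding E_def dot_def by measurable
  have [measurable]: "\<Lambda> \<in> borel_measurable M" unfolding \<Lambda>_def by measurable
  have G: "integrable M G" using int unfolding G_def \<Lambda>_def .
  have \<Lambda>0: "\<Lambda> x \<ge> 0" for x unfolding \<Lambda>_def by (intro sum_nonneg) auto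
  have dot: "norm (dot v x) \<le> norm v * \<Lambda> x" for v x
  proof -
    have "norm (dot v x) \<le> (\<Sum>j\<in>UNIV. norm (v $ j * complex_of_real (l j x)))"
      unfolding dot_def by (rule norm_sum)
    also have "\<dots> \<le> (\<Sum>j\<in>UNIV. norm v * \<bar>l j x\<bar>)"
      by (intro sum_mono) (auto simp: norm_mult intro!: mult_right_mono Finite_Cartesian_Product.norm_nth_le)
    finally show ?thesis by (simp add: \<Lambda>_def sum_distrib_left)
  qed
  have nE: "norm (E s x) * exp (e * \<Lambda> x) = \<bar>G x\<bar>" for x
    unfolding E_def G_def exp_add by (simp add: abs_mult)
  have nE': "norm (E s x) \<le> \<bar>G x\<bar>" for x
    using mult_left_mono[of 1 "exp (e * \<Lambda> x)" "norm (E s x)"] \<Lambda>0[of x] e nE[of x] by auto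
  have shift: "E (s + v) x = exp (- dot v x) * E s x" for v x
    unfolding E_def dot_def
    by (simp add: algebra_simps sum.distrib exp_add[symmetric] scaleR_conv_of_real)
  have intE: "integrable M (E s)"
    by (rule Bochner_Integration.integrable_bound[OF G]) (auto simp: nE')
  \<comment> \<open>Half of the margin absorbs the factor \<open>(\<Lambda> x)\<^sup>2\<close> of
    the remainder; the other half absorbs \<open>exp (norm (dot v x))\<close> as long as
    \<open>norm v \<le> e / 2\<close>.\<close>
  have quad: "(\<Lambda> x)\<^sup>2 \<le> 8 / e\<^sup>2 * exp (e / 2 * \<Lambda> x)" for x
  proof -
    have "exp (e / 2 * \<Lambda> x) \<ge> (e / 2 * \<Lambda> x)\<^sup>2 / 2"
      using exp_lower_Taylor_quadratic[of "e / 2 * \<Lambda> x"] mult_nonneg_nonneg[of "e / 2" "\<Lambda> x"] e \<Lambda>0[of x]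
      by linarith
    thus ?thesis using e by (simp add: field_simps power2_eq_square)
  qed
  have rem: "norm (E (s + v) x - E s x - (- dot v x * E s x)) \<le> (norm v)\<^sup>2 * (8 / e\<^sup>2 * \<bar>G x\<bar>)"
    if v: "norm v \<le> e / 2" for v x
  proof -
    have "norm (E (s + v) x - E s x - (- dot v x * E s x)) =
        norm ((exp (- dot v x) - 1 - (- dot v x)) * E s x)"
      by (simp add: shift algebra_simps)
    also have "\<dots> \<le> (norm (dot v x))\<^sup>2 * exp (norm (dot v x)) * norm (E s x)"
      using norm_exp_minus_one_minus_le[of "- dot v x"] by (auto simp: norm_mult intro!: mult_right_mono)
    also have "\<dots> \<le> (norm v * \<Lambda> x)\<^sup>2 * exp (e / 2 * \<Lambda> x) * norm (E s x)"
      using \<Lambda>0[of x] dot[of v x] order_trans[OF dot mult_right_mono[OF v \<Lambda>0]]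
      by (intro mult_right_mono mult_mono power_mono) auto
    also have "\<dots> \<le> (norm v)\<^sup>2 * (8 / e\<^sup>2 * exp (e / 2 * \<Lambda> x)) * exp (e / 2 * \<Lambda> x) * norm (E s x)"
      unfolding power_mult_distrib by (intro mult_right_mono mult_left_mono quad) auto
    also have "\<dots> = (norm v)\<^sup>2 * (8 / e\<^sup>2 * (norm (E s x) * exp (e * \<Lambda> x)))"
      by (simp add: exp_add[symmetric] mult_ac) 
    finally show ?thesis by (simp add: nE)
  qed
  have intD: "integrable M (\<lambda>x. dot v x * E s x)" for v
  proof (rule Bochner_Integration.integrable_bound)
    show "integrable M (\<lambda>x. norm v * (1 / e) * \<bar>G x\<bar>)" using G by auto
    have "\<Lambda> x \<le> 1 / e * exp (e * \<Lambda> x)" for x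
    proof -
      have "e * \<Lambda> x \<le> exp (e * \<Lambda> x)" using exp_ge_add_one_self[of "e * \<Lambda> x"] by linarith
      thus ?thesis using e by (simp add: field_simps)
    qed
    hence "norm (dot v x * E s x) \<le> norm v * (1 / e * exp (e * \<Lambda> x)) * norm (E s x)" for x
      unfolding norm_mult
      by (intro mult_right_mono order_trans[OF dot] mult_left_mono) auto
    also have "norm v * (1 / e * exp (e * \<Lambda> x)) * norm (E s x) =
      norm v * (1 / e) * \<bar>G x\<bar>" for x by (simp add: nE[symmetric])
    finally show "AE x in M. norm (dot v x * E s x) \<le> norm (norm v * (1 / e) * \<bar>G x\<bar>)" 
      using e by auto
  qed auto
  \<comment> \<open>The hypothesis concerns the parameter s alone; integrability at nearby
    parameters is read off from the bound for the remainder.\<close>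
  have intS: "integrable M (E (s + v))" if "norm v \<le> e / 2" for v
  proof -
    have "integrable M (\<lambda>x. (norm v)\<^sup>2 * (8 / e\<^sup>2 * \<bar>G x\<bar>))" using G by auto
    hence "integrable M (\<lambda>x. E (s + v) x - E s x - (- dot v x * E s x))"
      by (rule Bochner_Integration.integrable_bound) (use rem[OF that] in auto)
    from Bochner_Integration.integrable_add[OF this Bochner_Integration.integrable_diff[OF intE intD[of v]]]
    show ?thesis by (simp add: algebra_simps)
  qed
  define K where "K = 8 / e\<^sup>2 * (LINT x|M. \<bar>G x\<bar>)"
  have Dadd: "D (v + v') = D v + D v'" for v v'
  proof -
    have "dot (v + v') x * E s x = dot v x * E s x + dot v' x * E s x" for x
      unfolding dot_def by (simp add: algebra_simps sum.distrib)
    thus ?thesis unfolding D_def using intD[of v] intD[of v'] by simp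
  qed
  have Dscale: "D (c *s v) = c * D v" for c v
  proof -
    have "dot (c *s v) x = c * dot v x" for x
      unfolding dot_def by (simp add: sum_distrib_left mult_ac)
    thus ?thesis unfolding D_def using intD[of v] by (simp add: mult_ac)
  qed
  have "D (r *\<^sub>R v) = r *\<^sub>R D v" for r v
  proof -
    have "r *\<^sub>R v = complex_of_real r *s v" by (simp add: vec_eq_iff scaleR_conv_of_real[where 'a = complex])
    thus ?thesis by (simp add: Dscale scaleR_conv_of_real)
  qed
  hence "bounded_linear D"
    by (intro linear_conv_bounded_linear[THEN iffD1] linearI Dadd)
  have "((\<lambda>s. LINT x|M. E s x) has_derivative D) (at s)"
  proof (rule has_derivativeI_sandwich[of "e / 2"])
    show "bounded_linear D" by fact
    show "((\<lambda>y. K * norm (y - s)) \<longlongrightarrow> 0) (at s)"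
      by (auto intro!: tendsto_eq_intros)
    fix t assume t: "t \<noteq> s" "dist t s < e / 2"
    define v where "v = t - s"
    have v: "norm v \<le> e / 2" "t = s + v" "norm v > 0" using t by (auto simp: v_def dist_norm)
    have "(LINT x|M. E t x) - (LINT x|M. E s x) - D v = (LINT x|M. E (s + v) x - E s x - (- dot v x * E s x))"
      unfolding D_def using intE intD[of v] intS[OF v(1)] v(2) by simp
    also have "norm \<dots> \<le> (LINT x|M. (norm v)\<^sup>2 * (8 / e\<^sup>2 * \<bar>G x\<bar>))"
    proof (rule order_trans[OF integral_norm_bound Bochner_Integration.integral_mono])
      have "integrable M (\<lambda>x. - dot v x * E s x)" using intD[of v] by simp
      thus "integrable M (\<lambda>x. norm (E (s + v) x - E s x - (- dot v x * E s x)))"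
        by (intro integrable_norm Bochner_Integration.integrable_diff intE intS v(1))
      show "integrable M (\<lambda>x. (norm v)\<^sup>2 * (8 / e\<^sup>2 * \<bar>G x\<bar>))" using G by simp
    qed (rule rem[OF v(1)])
    also have "\<dots> = K * norm v * norm v" by (simp add: K_def power2_eq_square)
    finally show "norm ((LINT x|M. E t x) - (LINT x|M. E s x) - D (t - s)) / norm (t - s) \<le> K * norm (t - s)"
      unfolding v_def[symmetric] using v(3) by (subst pos_divide_le_eq) auto
  qed (use e in auto)
  thus ?thesis using Dscale unfolding mv_differentiable_def E_def by blast
qed

section \<open>Weighted integrals on the half-line\<close>

text \<open>Evaluation at 1, summation over the positive integers and integration against a periodic
  function all become integrals against sigma-finite measures on the reals, so that domination,
  Fubini and holomorphy are proved once for every pair of weights. \<open>Pol 1\<close> is plain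
  integration over the half-line, \<open>Pol [:- 1 / 2, 1:]\<close> the sawtooth.\<close>

datatype weight = Point | Comb | Pol "real poly"

fun wmeasure :: "weight \<Rightarrow> real measure" where
  "wmeasure Point = distr (count_space {1::nat}) borel real"
| "wmeasure Comb = distr (count_space {1::nat..}) borel real"
| "wmeasure (Pol b) = lborel"

text \<open>The indicator lets estimates that hold for x \<ge> 1 be used at every real point, in the
  same way for all weights.\<close>

fun wfun :: "weight \<Rightarrow> real \<Rightarrow> real" where
  "wfun (Pol b) x = indicator {1..} x * poly b (frac x)"
| "wfun w x = indicator {1..} x"

definition wt_integrable :: "weight \<Rightarrow> (real \<Rightarrow> complex) \<Rightarrow> bool" where
  "wt_integrable w \<phi> \<longleftrightarrow> integrable (wmeasure w) (\<lambda>x. wfun w x *\<^sub>R \<phi> x)"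

definition wt_integral :: "weight \<Rightarrow> (real \<Rightarrow> complex) \<Rightarrow> complex" where
  "wt_integral w \<phi> = (LINT x|wmeasure w. wfun w x *\<^sub>R \<phi> x)"

lemma sets_wmeasure [simp, measurable_cong]: "sets (wmeasure w) = sets borel"
  by (cases w) auto

lemma space_wmeasure [simp]: "space (wmeasure w) = UNIV"
  by (cases w) auto

lemma sigma_finite_distr_count_space:
  "sigma_finite_measure (distr (count_space N) borel (real :: nat \<Rightarrow> real))"
proof
  show "\<exists>A. countable A \<and> A \<subseteq> sets (distr (count_space N) borel real) \<and>
      \<Union> A = space (distr (count_space N) borel (real :: nat \<Rightarrow> real)) \<and>
      (\<forall>a\<in>A. emeasure (distr (count_space N) borel real) a \<noteq> \<infinity>)"
  proof (intro exI[of _ "range (\<lambda>n::nat. {..real n})"] conjI ballI)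
    show "\<Union> (range (\<lambda>n. {..real n})) = space (distr (count_space N) borel (real :: nat \<Rightarrow> real))"
      using real_arch_simple by auto
    fix a :: "real set" assume "a \<in> range (\<lambda>n. {..real n})"
    then obtain n :: nat where a: "a = {..real n}" by auto
    have "emeasure (distr (count_space N) borel real) a = emeasure (count_space N) (real -` a \<inter> N)"
      by (subst emeasure_distr) (auto simp: a)
    also have "\<dots> \<noteq> \<infinity>"
    proof (subst emeasure_count_space_finite)
      show "finite (real -` a \<inter> N)" by (rule finite_subset[of _ "{..n}"]) (auto simp: a)
    qed auto
    finally show "emeasure (distr (count_space N) borel real) a \<noteq> \<infinity>" .
  qed auto
qed

lemma sigma_finite_wmeasure: "sigma_finite_measure (wmeasure w)"
  by (cases w) (auto simp: sigma_finite_distr_count_space lborel.sigma_finite_measure_axioms)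

lemma pair_sigma_finite_wmeasure: "pair_sigma_finite (wmeasure v) (wmeasure w)"
  by (simp add: pair_sigma_finite_def sigma_finite_wmeasure)

lemma borel_measurable_wfun [measurable]: "wfun w \<in> borel_measurable borel"
proof (cases w)
  case (Pol b)
  have "poly b \<in> borel_measurable borel"
    by (intro borel_measurable_continuous_onI continuous_intros)
  moreover have "frac \<in> borel_measurable (borel :: real measure)"
    unfolding frac_def[abs_def] by measurable
  ultimately have "(\<lambda>x. poly b (frac x)) \<in> borel_measurable borel"
    by (metis measurable_compose)
  moreover have "wfun w = (\<lambda>x. indicator {1..} x * poly b (frac x))" by (auto simp: Pol)
  ultimately show ?thesis by simp
next
  case Point
  hence "wfun w = indicator {1..}" by auto
  thus ?thesis by simp
next
  case Comb
  hence "wfun w = indicator {1..}" by auto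
  thus ?thesis by simp
qed

lemma wfun_eq_0: "x < 1 \<Longrightarrow> wfun w x = 0"
  by (cases w) auto

text \<open>A periodic weight is bounded, because its values are those of a polynomial on [0, 1].
  One threshold for the exponent thus serves all weights.\<close>

lemma wt_integrable_powr:
  assumes "u > 1"
  shows "integrable (wmeasure w) (\<lambda>x. wfun w x * x powr (- u))"
proof (cases w)
  case Point
  show ?thesis unfolding Point wmeasure.simps
    by (subst integrable_distr_eq) (auto intro!: integrable_count_space)
next
  case Comb
  have "summable (\<lambda>n. real n powr (- u))" using assms by (simp add: summable_real_powr_iff)
  hence "Infinite_Set_Sum.abs_summable_on (\<lambda>n. real n powr (- u)) UNIV"
    by (subst abs_summable_on_nat_iff') auto
  hence "Infinite_Set_Sum.abs_summable_on (\<lambda>n. real n powr (- u)) {1..}"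
    by (rule abs_summable_on_subset) auto
  hence "integrable (count_space {1..}) (\<lambda>n::nat. real n powr (- u))"
    by (simp add: Infinite_Set_Sum.abs_summable_on_def)
  hence "integrable (count_space {1..}) (\<lambda>n::nat. wfun w (real n) * real n powr (- u))"
    by (rule Bochner_Integration.integrable_cong[THEN iffD1, rotated -1]) (auto simp: Comb)
  thus ?thesis unfolding Comb wmeasure.simps
    by (subst integrable_distr_eq) auto
next
  case (Pol b)
  have "((\<lambda>x. x powr (- u)) has_integral -(1 powr (- u + 1)) / (- u + 1)) {1..}"
    using assms by (intro has_integral_powr_to_inf) auto
  hence "(\<lambda>x::real. x powr (- u)) absolutely_integrable_on {1..}"
    by (intro nonnegative_absolutely_integrable_1) auto
  hence int: "set_integrable lborel {1..} (\<lambda>x::real. x powr (- u))"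
    unfolding set_integrable_def
    by (subst (asm) integrable_completion) auto
  have "compact (poly b ` {0..1})"
    by (intro compact_continuous_image continuous_intros) auto
  then obtain C where C: "\<And>t. t \<in> {0..1} \<Longrightarrow> \<bar>poly b t\<bar> \<le> C"
    using compact_imp_bounded[THEN bounded_iff[THEN iffD1]] by fastforce
  show ?thesis unfolding Pol wmeasure.simps
  proof (rule Bochner_Integration.integrable_bound)
    show "integrable lborel (\<lambda>x. C * (indicator {1..} x *\<^sub>R x powr (- u)))"
      using int unfolding set_integrable_def by simp
    have "\<bar>poly b (frac x)\<bar> \<le> C" for x :: real
      using C[of "frac x"] frac_ge_0[of x] frac_lt_1[of x] by auto
    thus "AE x in lborel. norm (wfun (Pol b) x * x powr (- u))
        \<le> norm (C * (indicator {1..} x *\<^sub>R x powr (- u)))"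
      by (intro AE_I2) (auto simp: abs_mult split: split_indicator intro!: mult_right_mono order_trans[OF _ abs_ge_self])
    show "(\<lambda>x. wfun (Pol b) x * x powr (- u)) \<in> borel_measurable lborel" by measurable
  qed
qed

lemma wt_integral_Point: "\<phi> \<in> borel_measurable borel \<Longrightarrow> wt_integral Point \<phi> = \<phi> 1"
  unfolding wt_integral_def wmeasure.simps
  by (subst integral_distr) (auto simp: lebesgue_integral_count_space_finite)

lemma wt_integral_Comb_sums:
  assumes [measurable]: "\<phi> \<in> borel_measurable borel" and int: "wt_integrable Comb \<phi>"
  shows "(\<lambda>n. \<phi> (real (Suc n))) sums wt_integral Comb \<phi>"
proof -
  have "integrable (count_space {1::nat..}) (\<lambda>n. wfun Comb (real n) *\<^sub>R \<phi> (real n))"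
    using int unfolding wt_integrable_def wmeasure.simps by (subst (asm) integrable_distr_eq) auto
  hence "integrable (count_space {1::nat..}) (\<lambda>n. \<phi> (real n))"
    by (rule Bochner_Integration.integrable_cong[THEN iffD1, rotated -1]) auto
  hence 1: "Infinite_Set_Sum.abs_summable_on (\<lambda>n. \<phi> (real n)) {1..}" by (simp add: Infinite_Set_Sum.abs_summable_on_def)
  have "wt_integral Comb \<phi> = (LINT n|count_space {1::nat..}. wfun Comb (real n) *\<^sub>R \<phi> (real n))"
    unfolding wt_integral_def wmeasure.simps by (subst integral_distr) auto
  also have "\<dots> = infsetsum (\<lambda>n. \<phi> (real n)) {1..}"
    unfolding infsetsum_def by (rule Bochner_Integration.integral_cong) auto
  finally have 2: "wt_integral Comb \<phi> = infsetsum (\<lambda>n. \<phi> (real n)) {1..}" .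
  have bij: "bij_betw Suc UNIV {1..}"
    by (rule bij_betwI[of _ _ _ "\<lambda>n. n - 1"]) auto
  from 1 have 3: "Infinite_Set_Sum.abs_summable_on (\<lambda>n. \<phi> (real (Suc n))) UNIV"
    by (subst abs_summable_on_reindex_bij_betw[OF bij])
  show ?thesis unfolding 2 
    by (subst infsetsum_reindex_bij_betw[OF bij, symmetric])
      (rule sums_infsetsum_nat'[OF 3])
qed

text \<open>
  On \<open>[m, m + 1]\<close> the integrand is the derivative of \<open>b (x - m) * \<phi> x\<close>; the sum on the right
  collects the jumps of the periodic extension of \<open>b\<close>. For \<open>b = x - 1 / 2\<close> this is the
  Euler--Maclaurin formula of first order.
\<close>

lemma wt_integral_by_parts:
  fixes \<phi> \<phi>' :: "real \<Rightarrow> complex"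
  assumes deriv: "\<And>x. x \<ge> 1 \<Longrightarrow> (\<phi> has_vector_derivative \<phi>' x) (at x)"
    and cont: "continuous_on {1..} \<phi>'"
    and meas [measurable]: "\<phi> \<in> borel_measurable borel" "\<phi>' \<in> borel_measurable borel"
    and lim: "(\<lambda>n. \<phi> (real n)) \<longlonglongrightarrow> 0"
    and int: "wt_integrable (Pol (pderiv b)) \<phi>" "wt_integrable (Pol b) \<phi>'"
    and comb: "poly b 1 = poly b 0 \<or> wt_integrable Comb \<phi>"
  shows "wt_integral (Pol (pderiv b)) \<phi> + wt_integral (Pol b) \<phi>' =
           (poly b 1 - poly b 0) * wt_integral Comb \<phi> - poly b 1 * \<phi> 1"
proof -
  define g where "g x = poly (pderiv b) (frac x) *\<^sub>R \<phi> x + poly b (frac x) *\<^sub>R \<phi>' x" for x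
  have gint: "set_integrable lborel {1..} g"
    using Bochner_Integration.integrable_add[OF int[unfolded wt_integrable_def wmeasure.simps]]
    unfolding set_integrable_def g_def by (simp add: scaleR_add_right)
  have lhs: "wt_integral (Pol (pderiv b)) \<phi> + wt_integral (Pol b) \<phi>' = (LINT x:{1..}|lborel. g x)"
    unfolding wt_integral_def wmeasure.simps set_lebesgue_integral_def
    by (subst Bochner_Integration.integral_add[symmetric])
      (use int in \<open>auto simp: wt_integrable_def g_def scaleR_add_right\<close>)
  \<comment> \<open>Tiles start at 1, whence the offset. Being half-open, they are disjoint and the
    fractional part has no jump on them; the closed interval needed for the fundamental theorem
    differs by a null set.\<close>
  define A where "A m = {real m + 1..<real m + 2}" for m :: nat
  have UnA: "(\<Union>m. A m) = {1..}"
  proof (intro set_eqI iffI)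
    fix x :: real assume "x \<in> {1..}"
    thus "x \<in> (\<Union>m. A m)" 
      by (intro UN_I[of "nat \<lfloor>x\<rfloor> - 1"]) (auto simp: A_def, linarith+)
  qed (auto simp: A_def)
  have piece: "(LINT x:A m|lborel. g x) = poly b 1 *\<^sub>R \<phi> (real m + 2) - poly b 0 *\<^sub>R \<phi> (real m + 1)" for m
  proof -
    define p where "p x = x - (real m + 1)" for x
    define h where "h x = poly (pderiv b) (p x) *\<^sub>R \<phi> x + poly b (p x) *\<^sub>R \<phi>' x" for x
    have p: "frac x = p x" if "x \<in> A m" for x
      using that by (intro frac_unique_iff[THEN iffD2]) (auto simp: A_def p_def)
    have "(LINT x:A m|lborel. g x) = (LINT x|lborel. indicator {real m + 1..real m + 2} x *\<^sub>R h x)"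
      unfolding set_lebesgue_integral_def
    proof (rule integral_cong_AE)
      have "AE x in lborel. x \<noteq> real m + 2" by (rule AE_lborel_singleton)
      thus "AE x in lborel. indicator (A m) x *\<^sub>R g x = indicator {real m + 1..real m + 2} x *\<^sub>R h x"
        by eventually_elim (auto simp: g_def h_def p split: split_indicator, auto simp: A_def)
      have "set_integrable lborel (A m) g"
        by (rule set_integrable_subset[OF gint]) (auto simp: A_def)
      thus "(\<lambda>x. indicator (A m) x *\<^sub>R g x) \<in> borel_measurable lborel"
        unfolding set_integrable_def by (rule borel_measurable_integrable)
      have [measurable]: "(\<lambda>x. poly c (p x)) \<in> borel_measurable borel" for c
        unfolding p_def by (intro borel_measurable_continuous_onI continuous_intros)
      show "(\<lambda>x. indicator {real m + 1..real m + 2} x *\<^sub>R h x) \<in> borel_measurable lborel"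
        unfolding h_def by measurable
    qed
    also have "\<dots> = poly b (p (real m + 2)) *\<^sub>R \<phi> (real m + 2) - poly b (p (real m + 1)) *\<^sub>R \<phi> (real m + 1)"
    proof (rule integral_FTC_Icc)
      fix x assume x: "real m + 1 \<le> x" "x \<le> real m + 2"
      have "((\<lambda>x. poly b (p x)) has_real_derivative poly (pderiv b) (p x) * 1) (at x)"
        unfolding p_def by (rule DERIV_chain2[OF poly_DERIV]) (auto intro!: derivative_eq_intros)
      hence 1: "((\<lambda>x. poly b (p x)) has_real_derivative poly (pderiv b) (p x)) (at x)" by simp
      have "(\<phi> has_vector_derivative \<phi>' x) (at x)" using deriv x by auto
      from has_vector_derivative_scaleR[OF 1 this]
      have "((\<lambda>x. poly b (p x) *\<^sub>R \<phi> x) has_vector_derivative h x) (at x)"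
        unfolding h_def by (subst add.commute)
      thus "((\<lambda>x. poly b (p x) *\<^sub>R \<phi> x) has_vector_derivative h x) (at x within {real m + 1..real m + 2})"
        by (rule has_vector_derivative_at_within)
    next
      have "continuous_on {1..} \<phi>"
        using deriv by (intro continuous_at_imp_continuous_on ballI has_vector_derivative_continuous) auto
      thus "continuous_on {real m + 1..real m + 2} h" unfolding h_def p_def
        by (intro continuous_intros continuous_on_subset[OF cont] continuous_on_subset[OF \<open>continuous_on {1..} \<phi>\<close>]) auto
    qed auto
    finally show ?thesis by (simp add: p_def)
  qed
  have "(LINT x:{1..}|lborel. g x) = (\<Sum>m. LINT x:A m|lborel. g x)"
    unfolding UnA[symmetric]
  proof (rule lebesgue_integral_countable_add)
    show "A i \<inter> A j = {}" if "i \<noteq> j" for i j using that by (auto simp: A_def)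
    show "set_integrable lborel (\<Union> (range A)) g" using gint by (simp add: UnA)
  qed (auto simp: A_def)
  also have "(\<lambda>m. LINT x:A m|lborel. g x) sums ((poly b 1 - poly b 0) * wt_integral Comb \<phi> - poly b 1 * \<phi> 1)"
  proof -
    \<comment> \<open>The boundary terms of a tile are split into \<open>poly b 1\<close> times a
      difference, which telescopes, and the jump \<open>poly b 1 - poly b 0\<close> times a value of
      \<open>\<phi>\<close>. If the jump is 0, the second series vanishes whether or not the sum
      over \<open>\<phi>\<close> converges.\<close>
    have 1: "(\<lambda>m. poly b 1 * (\<phi> (real (Suc (Suc m))) - \<phi> (real (Suc m)))) sums (poly b 1 * (0 - \<phi> (real (Suc 0))))"
      by (intro sums_mult telescope_sums LIMSEQ_Suc lim)
    have 2: "(\<lambda>m. (poly b 1 - poly b 0) * \<phi> (real (Suc m))) sums ((poly b 1 - poly b 0) * wt_integral Comb \<phi>)"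
    proof (cases "poly b 1 = poly b 0")
      case False
      with comb have "wt_integrable Comb \<phi>" by auto
      from wt_integral_Comb_sums[OF meas(1) this] show ?thesis by (rule sums_mult)
    qed auto
    show ?thesis using sums_add[OF 1 2] unfolding piece
      by (simp add: algebra_simps scaleR_conv_of_real)
  qed
  hence "(\<Sum>m. LINT x:A m|lborel. g x) = (poly b 1 - poly b 0) * wt_integral Comb \<phi> - poly b 1 * \<phi> 1"
    by (rule sums_unique[symmetric])
  finally show ?thesis using lhs by simp
qed

section \<open>Kernels of products of linear forms\<close>

text \<open>This is the product of the powers of the forms with exponents - s_j. Written with real
  logarithms it is entire in s, without any question of branches, and has the shape treated by
  \<open>mv_differentiable_integral_exp\<close>.\<close>

definition form_kernel :: "('n::finite \<Rightarrow> real) \<Rightarrow> ('n \<Rightarrow> real) \<Rightarrow> complex ^ 'n \<Rightarrow> real \<Rightarrow> real \<Rightarrow> complex" where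
  "form_kernel A B s x y = exp (- (\<Sum>j\<in>UNIV. s $ j * complex_of_real (ln (A j * x + B j * y))))"

definition kernel_integral ::
  "('n::finite \<Rightarrow> real) \<Rightarrow> ('n \<Rightarrow> real) \<Rightarrow> weight \<Rightarrow> weight \<Rightarrow> complex ^ 'n \<Rightarrow> complex" where
  "kernel_integral A B v w s = wt_integral w (\<lambda>y. wt_integral v (\<lambda>x. form_kernel A B s x y))"

text \<open>Since form i will be x and form k will be y, \<open>sum_except k\<close> adds the
  exponents of the forms containing x, and \<open>sum_except i\<close> those of the forms containing
  y.\<close>

definition sum_except :: "'n::finite \<Rightarrow> complex ^ 'n \<Rightarrow> complex" where
  "sum_except k s = (\<Sum>j\<in>UNIV - {k}. s $ j)"

definition sum_all :: "complex ^ 'n::finite \<Rightarrow> complex" where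
  "sum_all s = (\<Sum>j\<in>UNIV. s $ j)"

text \<open>The counters tell how far each condition has been moved to the left. For
  \<open>a = b = c = 0\<close> the conditions are those of absolute convergence: along x, along y,
  and jointly.\<close>

definition region :: "'n::finite \<Rightarrow> 'n \<Rightarrow> nat \<Rightarrow> nat \<Rightarrow> nat \<Rightarrow> (complex ^ 'n) set" where
  "region i k a b c = {s. Re (sum_except k s) > 1 - real a \<and> Re (sum_except i s) > 1 - real b \<and>
     Re (sum_all s) > 2 - real c}"

definition unit_shift :: "'n::finite \<Rightarrow> complex ^ 'n" where
  "unit_shift j = axis j 1"

lemma unit_shift_nth: "unit_shift j $ l = (if l = j then 1 else 0)"
  by (simp add: unit_shift_def axis_def)

lemma sum_all_eq: "sum_all s = s $ k + sum_except k s"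
  unfolding sum_all_def sum_except_def by (simp add: sum.remove)

lemma sum_all_add [simp]: "sum_all (s + t) = sum_all s + sum_all t"
  by (simp add: sum_all_def sum.distrib)

lemma sum_all_diff [simp]: "sum_all (s - t) = sum_all s - sum_all t"
  by (simp add: sum_all_def sum_subtractf)

lemma sum_except_add [simp]: "sum_except k (s + t) = sum_except k s + sum_except k t"
  by (simp add: sum_except_def sum.distrib)

lemma sum_except_diff [simp]: "sum_except k (s - t) = sum_except k s - sum_except k t"
  by (simp add: sum_except_def sum_subtractf)

lemma sum_all_unit_shift [simp]: "sum_all (unit_shift j) = 1"
  by (simp add: sum_all_def unit_shift_nth)

lemma sum_except_unit_shift [simp]: "sum_except k (unit_shift j) = (if j = k then 0 else 1)"
  using sum_all_eq[of "unit_shift j" k] by (auto simp: unit_shift_nth)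

lemma mv_differentiable_sum_except [simp]: "mv_differentiable (sum_except k) z"
  unfolding sum_except_def[abs_def] by (intro mv_differentiable_sum) auto

lemma mv_differentiable_sum_all [simp]: "mv_differentiable sum_all z"
  unfolding sum_all_def[abs_def] by (intro mv_differentiable_sum) auto

lemma continuous_on_sum_except: "continuous_on U (sum_except k)"
  by (intro continuous_at_imp_continuous_on ballI mv_differentiable_continuous) simp

lemma continuous_on_sum_all: "continuous_on U sum_all"
  by (intro continuous_at_imp_continuous_on ballI mv_differentiable_continuous) simp

lemma open_region [simp]: "open (region i k a b c)"
proof -
  have 1: "open {s. Re (sum_except k s) > r}" for k :: 'a and r
    by (rule open_Collect_less) (auto intro!: continuous_intros continuous_on_sum_except)
  have 2: "open {s :: complex ^ 'a. Re (sum_all s) > r}" for r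
    by (rule open_Collect_less) (auto intro!: continuous_intros continuous_on_sum_all)
  have "region i k a b c = {s. Re (sum_except k s) > 1 - real a} \<inter> {s. Re (sum_except i s) > 1 - real b}
      \<inter> {s. Re (sum_all s) > 2 - real c}" by (auto simp: region_def)
  thus ?thesis using 1 2 by (metis open_Int)
qed

lemma region_mono: "a \<le> a' \<Longrightarrow> b \<le> b' \<Longrightarrow> c \<le> c' \<Longrightarrow> region i k a b c \<subseteq> region i k a' b' c'"
  unfolding region_def by auto

lemma region_swap: "region k i b a c = region i k a b c"
  unfolding region_def by auto

lemma form_kernel_swap: "form_kernel B A s y x = form_kernel A B s x y"
  unfolding form_kernel_def by (simp add: add.commute)

lemma borel_measurable_form_kernel [measurable]:
  assumes [measurable]: "f \<in> borel_measurable M" "g \<in> borel_measurable M"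
  shows "(\<lambda>z. form_kernel A B s (f z) (g z)) \<in> borel_measurable M"
  unfolding form_kernel_def by measurable

lemma norm_form_kernel: "norm (form_kernel A B s x y) = exp (- (\<Sum>j\<in>UNIV. Re (s $ j) * ln (A j * x + B j * y)))"
  unfolding form_kernel_def by simp

text \<open>Every form other than x and y has two positive coefficients and is comparable to x + y,
  so growth depends on the mixed exponents only through their sum.\<close>

locale linear_forms =
  fixes A B :: "'n::finite \<Rightarrow> real" and i k :: 'n
  assumes ik: "i \<noteq> k"
    and i_coeffs [simp]: "A i = 1" "B i = 0"
    and k_coeffs [simp]: "A k = 0" "B k = 1"
    and coeffs_pos: "j \<noteq> i \<Longrightarrow> j \<noteq> k \<Longrightarrow> A j > 0 \<and> B j > 0"
begin

text \<open>Each statement about x gives its counterpart in y through this interpretation; both are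
  linked by \<open>kernel_integral_swap\<close>, that is, by Fubini.\<close>

lemma swapped: "linear_forms B A k i"
  by unfold_locales (use ik coeffs_pos in auto)

lemma coeffs_nonneg [simp]: "A j \<ge> 0" "B j \<ge> 0"
  using coeffs_pos[of j] ik by (cases "j = i"; cases "j = k"; force)+

lemma coeffs_add_pos: "A j + B j > 0"
  using coeffs_pos[of j] ik by (cases "j = i"; cases "j = k"; force)

lemma form_bounds:
  assumes "x \<ge> 1" "y \<ge> 1"
  shows "A j * x + B j * y \<ge> A j + B j" "A j * x + B j * y \<le> (A j + B j) * (x * y)"
proof -
  show "A j * x + B j * y \<ge> A j + B j"
    using assms mult_left_mono[of 1 x "A j"] mult_left_mono[of 1 y "B j"] by simp
  have "x \<le> x * y" "y \<le> x * y" using assms by auto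
  thus "A j * x + B j * y \<le> (A j + B j) * (x * y)"
    using mult_left_mono[of x "x * y" "A j"] mult_left_mono[of y "x * y" "B j"]
    by (simp add: algebra_simps)
qed

lemma form_pos: "x \<ge> 1 \<Longrightarrow> y \<ge> 1 \<Longrightarrow> A j * x + B j * y > 0"
  using form_bounds(1)[of x y j] coeffs_add_pos[of j] by linarith

lemma abs_ln_form_le:
  assumes "x \<ge> 1" "y \<ge> 1"
  shows "\<bar>ln (A j * x + B j * y)\<bar> \<le> \<bar>ln (A j + B j)\<bar> + ln x + ln y"
proof -
  have "ln (A j * x + B j * y) \<ge> ln (A j + B j)"
    using form_bounds(1)[OF assms, of j] coeffs_add_pos[of j] by simp
  moreover have "ln (A j * x + B j * y) \<le> ln ((A j + B j) * (x * y))"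
    using form_bounds(2)[OF assms, of j] form_pos[OF assms, of j] by (subst ln_le_cancel_iff) auto
  moreover have "ln ((A j + B j) * (x * y)) = ln (A j + B j) + ln x + ln y"
    using assms coeffs_add_pos[of j] by (simp add: ln_mult)
  moreover have "ln x \<ge> 0" "ln y \<ge> 0" using assms by auto
  ultimately show ?thesis by linarith
qed

lemma abs_ln_form_diff_le:
  assumes "x \<ge> 1" "y \<ge> 1" and j: "j \<noteq> i" "j \<noteq> k"
  shows "\<bar>ln (A j * x + B j * y) - ln (x + y)\<bar> \<le> \<bar>ln (min (A j) (B j))\<bar> + \<bar>ln (max (A j) (B j))\<bar>"
proof -
  note pos = coeffs_pos[OF j]
  have "min (A j) (B j) * (x + y) \<le> A j * x + B j * y"
    unfolding distrib_left using assms by (intro add_mono mult_right_mono) auto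
  hence "ln (min (A j) (B j) * (x + y)) \<le> ln (A j * x + B j * y)"
    using pos assms form_pos[OF assms(1,2), of j] by (subst ln_le_cancel_iff) auto
  moreover have "ln (min (A j) (B j) * (x + y)) = ln (min (A j) (B j)) + ln (x + y)"
    using pos assms by (intro ln_mult_pos) auto
  moreover have "A j * x + B j * y \<le> max (A j) (B j) * (x + y)"
    unfolding distrib_left using assms by (intro add_mono mult_right_mono) auto
  hence "ln (max (A j) (B j) * (x + y)) \<ge> ln (A j * x + B j * y)"
    using pos assms form_pos[OF assms(1,2), of j] by (subst ln_le_cancel_iff) auto
  moreover have "ln (max (A j) (B j) * (x + y)) = ln (max (A j) (B j)) + ln (x + y)"
    using pos assms by (intro ln_mult_pos) auto
  ultimately show ?thesis by linarith
qed

lemma sum_UNIV_split: "(\<Sum>j\<in>UNIV. f j) = f i + f k + (\<Sum>j\<in>UNIV - {i,k}. f j)" for f :: "'n \<Rightarrow> 'b::comm_monoid_add"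
proof -
  have "(\<Sum>j\<in>UNIV. f j) = f i + (\<Sum>j\<in>UNIV - {i}. f j)" by (rule sum.remove) auto
  also have "(\<Sum>j\<in>UNIV - {i}. f j) = f k + (\<Sum>j\<in>UNIV - {i} - {k}. f j)"
    using ik by (intro sum.remove) auto
  also have "UNIV - {i} - {k} = UNIV - {i,k}" by auto
  finally show ?thesis by (simp add: add_ac)
qed

lemma sum_except_k_split: "sum_except k s = s $ i + (\<Sum>j\<in>UNIV - {i,k}. s $ j)"
  using sum_UNIV_split[of "($) s"] sum_all_eq[of s k] by (simp add: sum_all_def)

lemma sum_except_i_split: "sum_except i s = s $ k + (\<Sum>j\<in>UNIV - {i,k}. s $ j)"
  using sum_UNIV_split[of "($) s"] sum_all_eq[of s i] by (simp add: sum_all_def)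

text \<open>
  With \<open>\<rho>\<close> the total exponent of the mixed forms, \<open>(x + y) powr (- \<rho>)\<close> is split as
  \<open>x powr (- \<theta>) * y powr (\<theta> - \<rho>)\<close> for a suitable \<open>0 \<le> \<theta> \<le> \<rho>\<close>; for negative \<open>\<rho>\<close> one uses
  \<open>x + y \<le> 2 * x * y\<close>.
\<close>

lemma log_kernel_bound:
  assumes s: "s \<in> region i k 0 0 0"
  obtains K u v where "u > 1" "v > 1"
    "\<And>x y. x \<ge> 1 \<Longrightarrow> y \<ge> 1 \<Longrightarrow>
       - (\<Sum>j\<in>UNIV. Re (s $ j) * ln (A j * x + B j * y)) \<le> K - u * ln x - v * ln y"
proof -
  define p q where "p = Re (s $ i)" and "q = Re (s $ k)"
  define \<rho> where "\<rho> = (\<Sum>j\<in>UNIV - {i,k}. Re (s $ j))"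
  define K where "K = (\<Sum>j\<in>UNIV - {i,k}. \<bar>Re (s $ j)\<bar> * (\<bar>ln (min (A j) (B j))\<bar> + \<bar>ln (max (A j) (B j))\<bar>))"
  have conds: "p + \<rho> > 1" "q + \<rho> > 1" "p + q + \<rho> > 2"
    using s sum_all_eq[of s i] unfolding region_def
    by (auto simp: sum_except_k_split sum_except_i_split p_def q_def \<rho>_def)
  have K: "- (\<Sum>j\<in>UNIV. Re (s $ j) * ln (A j * x + B j * y)) \<le> K - p * ln x - q * ln y - \<rho> * ln (x + y)"
    if xy: "x \<ge> 1" "y \<ge> 1" for x y
  proof -
    have "- (Re (s $ j) * ln (A j * x + B j * y)) \<le>
        \<bar>Re (s $ j)\<bar> * (\<bar>ln (min (A j) (B j))\<bar> + \<bar>ln (max (A j) (B j))\<bar>) - Re (s $ j) * ln (x + y)"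
      if "j \<in> UNIV - {i,k}" for j
    proof -
      have "- (Re (s $ j) * (ln (A j * x + B j * y) - ln (x + y))) \<le>
          \<bar>Re (s $ j) * (ln (A j * x + B j * y) - ln (x + y))\<bar>" by linarith
      also have "\<dots> \<le> \<bar>Re (s $ j)\<bar> * (\<bar>ln (min (A j) (B j))\<bar> + \<bar>ln (max (A j) (B j))\<bar>)"
        unfolding abs_mult using abs_ln_form_diff_le[OF xy, of j] that by (intro mult_left_mono) auto
      finally show ?thesis by (simp add: algebra_simps)
    qed
    hence "- (\<Sum>j\<in>UNIV - {i,k}. Re (s $ j) * ln (A j * x + B j * y)) \<le> K - \<rho> * ln (x + y)"
      unfolding K_def \<rho>_def sum_distrib_right sum_negf[symmetric] sum_subtractf[symmetric]
      by (rule sum_mono)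
    thus ?thesis by (simp add: sum_UNIV_split p_def q_def)
  qed
  show ?thesis
  proof (cases "\<rho> \<ge> 0")
    case True
    \<comment> \<open>The midpoint of the interval in which \<theta> has to lie: between
      \<open>max 0 (1 - p)\<close> and \<open>min \<rho> (\<rho> + q - 1)\<close>. Besides \<rho>
      \<ge> 0, its nonemptiness takes exactly the three inequalities of the region.\<close>
    define \<theta> where "\<theta> = (max 0 (1 - p) + min \<rho> (\<rho> + q - 1)) / 2"
    have \<theta>: "0 \<le> \<theta>" "\<theta> \<le> \<rho>" "p + \<theta> > 1" "q + (\<rho> - \<theta>) > 1"
      using conds True unfolding \<theta>_def by (auto simp: max_def min_def field_simps)
    show ?thesis
    proof (rule that[OF \<theta>(3,4)])
      fix x y :: real assume xy: "x \<ge> 1" "y \<ge> 1"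
      have "\<theta> * ln x \<le> \<theta> * ln (x + y)" "(\<rho> - \<theta>) * ln y \<le> (\<rho> - \<theta>) * ln (x + y)"
        using xy \<theta> by (auto intro!: mult_left_mono)
      thus "- (\<Sum>j\<in>UNIV. Re (s $ j) * ln (A j * x + B j * y)) \<le>
          K - (p + \<theta>) * ln x - (q + (\<rho> - \<theta>)) * ln y"
        using K[OF xy] by (simp add: algebra_simps)
    qed
  next
    case False
    show ?thesis
    proof (rule that[OF conds(1,2)])
      fix x y :: real assume xy: "x \<ge> 1" "y \<ge> 1"
      have "x \<le> x * y" "y \<le> x * y" using xy by auto
      hence "x + y \<le> 2 * (x * y)" by linarith
      hence "ln (x + y) \<le> ln (2 * (x * y))" using xy by (subst ln_le_cancel_iff) auto
      also have "\<dots> = ln 2 + ln x + ln y" using xy by (simp add: ln_mult)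
      finally have "(- \<rho>) * ln (x + y) \<le> (- \<rho>) * (ln 2 + ln x + ln y)"
        using False by (intro mult_left_mono) auto
      thus "- (\<Sum>j\<in>UNIV. Re (s $ j) * ln (A j * x + B j * y)) \<le>
          (K - \<rho> * ln 2) - (p + \<rho>) * ln x - (q + \<rho>) * ln y"
        using K[OF xy] by (simp add: algebra_simps)
    qed
  qed
qed

lemma log_kernel_bound_margin:
  assumes s: "s \<in> region i k 0 0 0"
  obtains e K u v where "e > 0" "u > 1" "v > 1"
    "\<And>x y. x \<ge> 1 \<Longrightarrow> y \<ge> 1 \<Longrightarrow>
       - (\<Sum>j\<in>UNIV. Re (s $ j) * ln (A j * x + B j * y)) + e * (\<Sum>j\<in>UNIV. \<bar>ln (A j * x + B j * y)\<bar>)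
         \<le> K - u * ln x - v * ln y"
proof -
  obtain K u v where uv: "u > 1" "v > 1" and K:
    "\<And>x y. x \<ge> 1 \<Longrightarrow> y \<ge> 1 \<Longrightarrow>
       - (\<Sum>j\<in>UNIV. Re (s $ j) * ln (A j * x + B j * y)) \<le> K - u * ln x - v * ln y"
    by (rule log_kernel_bound[OF s], rule that)
  define n where "n = real CARD('n)"
  define K' where "K' = (\<Sum>j\<in>UNIV. \<bar>ln (A j + B j)\<bar>)"
  \<comment> \<open>The n logarithms together cost \<open>e * n\<close> in each exponent. This value
    of e makes the loss half of the smaller excess of u and v over 1.\<close>
  define e where "e = min (u - 1) (v - 1) / (2 * n)"
  have n: "n > 0" by (simp add: n_def)
  have e: "e > 0" using uv n by (simp add: e_def)
  have en: "e * n = min (u - 1) (v - 1) / 2" using n by (simp add: e_def)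
  show ?thesis
  proof (rule that[OF e, of "u - e * n" "v - e * n" "K + e * K'"])
    fix x y :: real assume xy: "x \<ge> 1" "y \<ge> 1"
    have "(\<Sum>j\<in>UNIV. \<bar>ln (A j * x + B j * y)\<bar>) \<le> (\<Sum>j\<in>UNIV. \<bar>ln (A j + B j)\<bar> + ln x + ln y)"
      by (intro sum_mono abs_ln_form_le xy)
    also have "\<dots> = K' + n * ln x + n * ln y" by (simp add: sum.distrib K'_def n_def)
    finally have "e * (\<Sum>j\<in>UNIV. \<bar>ln (A j * x + B j * y)\<bar>) \<le> e * (K' + n * ln x + n * ln y)"
      using e by (intro mult_left_mono) auto
    thus "- (\<Sum>j\<in>UNIV. Re (s $ j) * ln (A j * x + B j * y)) + e * (\<Sum>j\<in>UNIV. \<bar>ln (A j * x + B j * y)\<bar>)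
         \<le> K + e * K' - (u - e * n) * ln x - (v - e * n) * ln y"
      using K[OF xy] by (simp add: algebra_simps)
  qed (use uv en in auto)
qed

section \<open>Domination, Fubini and holomorphy in the region of convergence\<close>

lemma kernel_bound:
  assumes s: "s \<in> region i k 0 0 0"
  obtains C u v where "C > 0" "u > 1" "v > 1"
    "\<And>x y. x \<ge> 1 \<Longrightarrow> y \<ge> 1 \<Longrightarrow> norm (form_kernel A B s x y) \<le> C * (x powr (- u) * y powr (- v))"
proof -
  obtain K u v where uv: "u > 1" "v > 1" and K:
    "\<And>x y. x \<ge> 1 \<Longrightarrow> y \<ge> 1 \<Longrightarrow>
       - (\<Sum>j\<in>UNIV. Re (s $ j) * ln (A j * x + B j * y)) \<le> K - u * ln x - v * ln y"
    by (rule log_kernel_bound[OF s], rule that)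
  show ?thesis
  proof (rule that[OF _ uv])
    fix x y :: real assume xy: "x \<ge> 1" "y \<ge> 1"
    have "norm (form_kernel A B s x y) \<le> exp (K - u * ln x - v * ln y)"
      unfolding norm_form_kernel using K[OF xy] by simp
    also have "\<dots> = exp K * (x powr (- u) * y powr (- v))"
      using xy by (simp add: powr_def exp_add[symmetric])
    finally show "norm (form_kernel A B s x y) \<le> exp K * (x powr (- u) * y powr (- v))" .
  qed auto
qed

lemma integrable_powr_product:
  assumes "u > 1" "v > 1"
  shows "integrable (wmeasure w \<Otimes>\<^sub>M wmeasure w')
    (\<lambda>z. wfun w (fst z) * wfun w' (snd z) * (fst z powr (- u) * snd z powr (- v)))"
proof -
  interpret pair_sigma_finite "wmeasure w" "wmeasure w'" by (rule pair_sigma_finite_wmeasure)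
  note ints = wt_integrable_powr[OF assms(1), of w] wt_integrable_powr[OF assms(2), of w']
  have eq: "(\<lambda>z. wfun w (fst z) * wfun w' (snd z) * (fst z powr (- u) * snd z powr (- v))) =
    (\<lambda>(x, y). (wfun w x * x powr (- u)) * (wfun w' y * y powr (- v)))" by (auto simp: mult_ac)
  show ?thesis unfolding eq
  proof (rule Fubini_integrable)
    show "integrable (wmeasure w) (\<lambda>x. LINT y|wmeasure w'. norm (case (x, y) of
        (x, y) \<Rightarrow> (wfun w x * x powr (- u)) * (wfun w' y * y powr (- v))))"
      using integrable_norm[OF ints(1)] by (simp add: abs_mult)
    show "AE x in wmeasure w. integrable (wmeasure w') (\<lambda>y. case (x, y) of
        (x, y) \<Rightarrow> (wfun w x * x powr (- u)) * (wfun w' y * y powr (- v)))"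
      using ints(2) by simp
  qed measurable
qed

lemma wfun_mono:
  assumes "\<And>x y. x \<ge> 1 \<Longrightarrow> y \<ge> 1 \<Longrightarrow> \<bar>f x y\<bar> \<le> (g x y :: real)"
  shows "\<bar>wfun w x * wfun w' y * f x y\<bar> \<le> \<bar>wfun w x * wfun w' y * g x y\<bar>"
proof (cases "x \<ge> 1 \<and> y \<ge> 1")
  case True
  thus ?thesis using assms[of x y] by (auto simp: abs_mult intro!: mult_left_mono)
qed (auto simp: wfun_eq_0 not_le)

lemma kernel_integrable_pair:
  assumes s: "s \<in> region i k 0 0 0"
  shows "integrable (wmeasure v \<Otimes>\<^sub>M wmeasure w)
    (\<lambda>z. (wfun v (fst z) * wfun w (snd z)) *\<^sub>R form_kernel A B s (fst z) (snd z))"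
proof -
  obtain C p q where C: "C > 0" "p > 1" "q > 1" and bound:
    "\<And>x y. x \<ge> 1 \<Longrightarrow> y \<ge> 1 \<Longrightarrow> norm (form_kernel A B s x y) \<le> C * (x powr (- p) * y powr (- q))"
    by (rule kernel_bound[OF s], rule that)
  show ?thesis
  proof (rule Bochner_Integration.integrable_bound)
    show "integrable (wmeasure v \<Otimes>\<^sub>M wmeasure w)
      (\<lambda>z. C * (wfun v (fst z) * wfun w (snd z) * (fst z powr (- p) * snd z powr (- q))))"
      using integrable_powr_product[OF C(2,3), of v w] by simp
    show "AE z in wmeasure v \<Otimes>\<^sub>M wmeasure w.
        norm ((wfun v (fst z) * wfun w (snd z)) *\<^sub>R form_kernel A B s (fst z) (snd z)) \<le>
        norm (C * (wfun v (fst z) * wfun w (snd z) * (fst z powr (- p) * snd z powr (- q))))"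
      using wfun_mono[of "\<lambda>x y. norm (form_kernel A B s x y)" "\<lambda>x y. C * (x powr (- p) * y powr (- q))" v _ w] bound
      by (intro AE_I2) (simp add: abs_mult mult_ac)
  qed measurable
qed

text \<open>Three uses of Fubini: the product integral serves holomorphy, the exchanged order serves
  the symmetry in x and y, and integrability of the inner integral allows relations obtained for
  fixed y to be integrated over y.\<close>

lemma kernel_integral_eq_pair:
  assumes s: "s \<in> region i k 0 0 0"
  shows "kernel_integral A B v w s = (LINT z|(wmeasure v \<Otimes>\<^sub>M wmeasure w).
    (wfun v (fst z) * wfun w (snd z)) *\<^sub>R form_kernel A B s (fst z) (snd z))"
    and "kernel_integral A B v w s = (LINT x|wmeasure v. LINT y|wmeasure w.
    (wfun v x * wfun w y) *\<^sub>R form_kernel A B s x y)"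
    and "wt_integrable w (\<lambda>y. wt_integral v (\<lambda>x. form_kernel A B s x y))"
proof -
  interpret pair_sigma_finite "wmeasure v" "wmeasure w" by (rule pair_sigma_finite_wmeasure)
  note int = kernel_integrable_pair[OF s, of v w]
  have int': "integrable (wmeasure v \<Otimes>\<^sub>M wmeasure w)
    (case_prod (\<lambda>x y. (wfun v x * wfun w y) *\<^sub>R form_kernel A B s x y))"
    using int by (simp add: case_prod_beta')
  have eq: "(LINT x|wmeasure v. (wfun v x * wfun w y) *\<^sub>R form_kernel A B s x y) =
      wfun w y *\<^sub>R wt_integral v (\<lambda>x. form_kernel A B s x y)" for y
    unfolding wt_integral_def by (simp add: mult.commute flip: integral_scaleR_right)
  show "kernel_integral A B v w s = (LINT z|(wmeasure v \<Otimes>\<^sub>M wmeasure w).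
    (wfun v (fst z) * wfun w (snd z)) *\<^sub>R form_kernel A B s (fst z) (snd z))"
    using integral_snd[OF int'] unfolding eq kernel_integral_def wt_integral_def[of w]
    by (simp add: case_prod_beta')
  show "kernel_integral A B v w s = (LINT x|wmeasure v. LINT y|wmeasure w.
    (wfun v x * wfun w y) *\<^sub>R form_kernel A B s x y)"
    using Fubini_integral[OF int'] unfolding eq kernel_integral_def wt_integral_def[of w] .
  show "wt_integrable w (\<lambda>y. wt_integral v (\<lambda>x. form_kernel A B s x y))"
    using integrable_snd[OF int'] unfolding eq wt_integrable_def .
qed

lemma kernel_integral_swap:
  assumes s: "s \<in> region i k 0 0 0"
  shows "kernel_integral B A w v s = kernel_integral A B v w s"
proof -
  have "kernel_integral B A w v s = (LINT x|wmeasure v. LINT y|wmeasure w.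
    (wfun v x * wfun w y) *\<^sub>R form_kernel A B s x y)"
    unfolding kernel_integral_def wt_integral_def form_kernel_swap[of B A]
    by (simp flip: integral_scaleR_right)
  thus ?thesis unfolding kernel_integral_eq_pair(2)[OF s] .
qed

lemma wt_integrable_kernel:
  assumes s: "s \<in> region i k 0 0 0" and y: "y \<ge> 1"
  shows "wt_integrable v (\<lambda>x. form_kernel A B s x y)"
proof -
  obtain C p q where C: "C > 0" "p > 1" "q > 1" and bound:
    "\<And>x y. x \<ge> 1 \<Longrightarrow> y \<ge> 1 \<Longrightarrow> norm (form_kernel A B s x y) \<le> C * (x powr (- p) * y powr (- q))"
    by (rule kernel_bound[OF s], rule that)
  show ?thesis unfolding wt_integrable_def
  proof (rule Bochner_Integration.integrable_bound)
    show "integrable (wmeasure v) (\<lambda>x. C * y powr (- q) * (wfun v x * x powr (- p)))"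
      using wt_integrable_powr[OF C(2), of v] by simp
    have "norm (wfun v x *\<^sub>R form_kernel A B s x y) \<le> norm (C * y powr (- q) * (wfun v x * x powr (- p)))" for x
    proof (cases "x \<ge> 1")
      case True
      thus ?thesis using mult_left_mono[OF bound[OF True y], of "\<bar>wfun v x\<bar>"] C
        by (simp add: abs_mult mult_ac)
    qed (simp add: wfun_eq_0)
    thus "AE x in wmeasure v. norm (wfun v x *\<^sub>R form_kernel A B s x y) \<le> norm (C * y powr (- q) * (wfun v x * x powr (- p)))"
      by simp
    show "(\<lambda>x. wfun v x *\<^sub>R form_kernel A B s x y) \<in> borel_measurable (wmeasure v)"
      by measurable
  qed
qed

lemma kernel_integral_holomorphic: "mv_holomorphic_on (kernel_integral A B v w) (region i k 0 0 0)"
  unfolding mv_holomorphic_on_iff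
proof (intro conjI ballI)
  fix s assume s: "s \<in> region i k 0 0 0"
  obtain e K p q where e: "e > 0" "p > 1" "q > 1" and K:
    "\<And>x y. x \<ge> 1 \<Longrightarrow> y \<ge> 1 \<Longrightarrow>
       - (\<Sum>j\<in>UNIV. Re (s $ j) * ln (A j * x + B j * y)) + e * (\<Sum>j\<in>UNIV. \<bar>ln (A j * x + B j * y)\<bar>)
         \<le> K - p * ln x - q * ln y"
    by (rule log_kernel_bound_margin[OF s], rule that)
  define l where "l j z = ln (A j * fst z + B j * snd z)" for j and z :: "real \<times> real"
  define g where "g x y = exp (- (\<Sum>j\<in>UNIV. Re (s $ j) * ln (A j * x + B j * y)) +
      e * (\<Sum>j\<in>UNIV. \<bar>ln (A j * x + B j * y)\<bar>))" for x y
  have g: "\<bar>g x y\<bar> \<le> exp K * (x powr (- p) * y powr (- q))" if "x \<ge> 1" "y \<ge> 1" for x y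
  proof -
    have "g x y \<le> exp (K - p * ln x - q * ln y)" unfolding g_def using K[OF that] by simp
    also have "\<dots> = exp K * (x powr (- p) * y powr (- q))"
      using that by (simp add: powr_def exp_add[symmetric])
    finally show ?thesis by (simp add: g_def)
  qed
  have [measurable]: "l j \<in> borel_measurable (wmeasure v \<Otimes>\<^sub>M wmeasure w)" for j
    unfolding l_def by measurable
  have "mv_differentiable (\<lambda>s. LINT z|(wmeasure v \<Otimes>\<^sub>M wmeasure w).
      (wfun v (fst z) * wfun w (snd z)) *\<^sub>R exp (- (\<Sum>j\<in>UNIV. s $ j * complex_of_real (l j z)))) s"
  proof (rule mv_differentiable_integral_exp[OF _ _ e(1)])
    show "integrable (wmeasure v \<Otimes>\<^sub>M wmeasure w) (\<lambda>z. wfun v (fst z) * wfun w (snd z) *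
        exp (- (\<Sum>j\<in>UNIV. Re (s $ j) * l j z) + e * (\<Sum>j\<in>UNIV. \<bar>l j z\<bar>)))"
    proof (rule Bochner_Integration.integrable_bound)
      show "integrable (wmeasure v \<Otimes>\<^sub>M wmeasure w)
        (\<lambda>z. exp K * (wfun v (fst z) * wfun w (snd z) * (fst z powr (- p) * snd z powr (- q))))"
        using integrable_powr_product[OF e(2,3), of v w] by simp
      show "AE z in wmeasure v \<Otimes>\<^sub>M wmeasure w. norm (wfun v (fst z) * wfun w (snd z) *
          exp (- (\<Sum>j\<in>UNIV. Re (s $ j) * l j z) + e * (\<Sum>j\<in>UNIV. \<bar>l j z\<bar>))) \<le>
          norm (exp K * (wfun v (fst z) * wfun w (snd z) * (fst z powr (- p) * snd z powr (- q))))"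
      proof (intro AE_I2)
        fix z :: "real \<times> real"
        have "\<bar>wfun v (fst z) * wfun w (snd z) * g (fst z) (snd z)\<bar> \<le>
            \<bar>wfun v (fst z) * wfun w (snd z) * (exp K * (fst z powr (- p) * snd z powr (- q)))\<bar>"
          by (rule wfun_mono) (rule g)
        also have "wfun v (fst z) * wfun w (snd z) * (exp K * (fst z powr (- p) * snd z powr (- q))) =
            exp K * (wfun v (fst z) * wfun w (snd z) * (fst z powr (- p) * snd z powr (- q)))"
          by (rule mult.left_commute)
        finally show "norm (wfun v (fst z) * wfun w (snd z) *
          exp (- (\<Sum>j\<in>UNIV. Re (s $ j) * l j z) + e * (\<Sum>j\<in>UNIV. \<bar>l j z\<bar>))) \<le>
          norm (exp K * (wfun v (fst z) * wfun w (snd z) * (fst z powr (- p) * snd z powr (- q))))"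
          unfolding g_def l_def real_norm_def .
      qed
      show "(\<lambda>z. wfun v (fst z) * wfun w (snd z) *
          exp (- (\<Sum>j\<in>UNIV. Re (s $ j) * l j z) + e * (\<Sum>j\<in>UNIV. \<bar>l j z\<bar>)))
          \<in> borel_measurable (wmeasure v \<Otimes>\<^sub>M wmeasure w)" by measurable
    qed
    show "(\<lambda>z. wfun v (fst z) * wfun w (snd z)) \<in> borel_measurable (wmeasure v \<Otimes>\<^sub>M wmeasure w)"
      by measurable
  qed fact
  thus "mv_differentiable (kernel_integral A B v w) s"
  proof (rule mv_differentiable_cong[OF _ open_region s])
    fix t assume "t \<in> region i k 0 0 0"
    thus "(LINT z|(wmeasure v \<Otimes>\<^sub>M wmeasure w). (wfun v (fst z) * wfun w (snd z)) *\<^sub>R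
        exp (- (\<Sum>j\<in>UNIV. t $ j * complex_of_real (l j z)))) = kernel_integral A B v w t"
      by (subst kernel_integral_eq_pair(1)) (auto simp: form_kernel_def l_def)
  qed
qed simp

end

section \<open>Integration by parts\<close>

lemma wt_integral_cong:
  assumes "\<And>x. x \<ge> 1 \<Longrightarrow> f x = g x"
  shows "wt_integral w f = wt_integral w g"
  unfolding wt_integral_def
  by (rule Bochner_Integration.integral_cong[OF refl]) (metis assms wfun_eq_0 linorder_not_le scaleR_zero_left)

lemma wt_integrable_add: "wt_integrable w f \<Longrightarrow> wt_integrable w g \<Longrightarrow> wt_integrable w (\<lambda>x. f x + g x)"
  unfolding wt_integrable_def scaleR_add_right by (rule Bochner_Integration.integrable_add)

lemma wt_integral_add:
  "wt_integrable w f \<Longrightarrow> wt_integrable w g \<Longrightarrow>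
     wt_integral w (\<lambda>x. f x + g x) = wt_integral w f + wt_integral w g"
  unfolding wt_integrable_def wt_integral_def scaleR_add_right by (rule Bochner_Integration.integral_add)

lemma wt_integrable_mult: "wt_integrable w f \<Longrightarrow> wt_integrable w (\<lambda>x. c * f x)"
  unfolding wt_integrable_def mult_scaleR_right[symmetric]
  by (rule Bochner_Integration.integrable_mult_right)

lemma wt_integral_mult: "wt_integral w (\<lambda>x. c * f x) = c * wt_integral w f"
  unfolding wt_integral_def mult_scaleR_right[symmetric]
  by (rule Bochner_Integration.integral_mult_right_zero)

lemma wt_integrable_zero [simp]: "wt_integrable w (\<lambda>x. 0)"
  unfolding wt_integrable_def by simp

lemma wt_integral_zero [simp]: "wt_integral w (\<lambda>x. 0) = 0"
  unfolding wt_integral_def by simp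

lemma wt_integral_Pol_0 [simp]: "wt_integral (Pol 0) f = 0" "wt_integrable (Pol 0) f"
  unfolding wt_integral_def wt_integrable_def by auto

lemma wt_integrable_lincomb:
  "(\<And>j. j \<in> J \<Longrightarrow> c j = 0 \<or> wt_integrable w (f j)) \<Longrightarrow> wt_integrable w (\<lambda>x. \<Sum>j\<in>J. c j * f j x)"
proof (induction J rule: infinite_finite_induct)
  case (insert a J)
  have "wt_integrable w (\<lambda>x. c a * f a x)"
    using insert.prems[of a] by (auto intro: wt_integrable_mult)
  with insert show ?case by (auto intro!: wt_integrable_add)
qed auto

lemma wt_integral_lincomb:
  "(\<And>j. j \<in> J \<Longrightarrow> c j = 0 \<or> wt_integrable w (f j)) \<Longrightarrow>
     wt_integral w (\<lambda>x. \<Sum>j\<in>J. c j * f j x) = (\<Sum>j\<in>J. c j * wt_integral w (f j))"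
proof (induction J rule: infinite_finite_induct)
  case (insert a J)
  have "wt_integrable w (\<lambda>x. c a * f a x)"
    using insert.prems[of a] by (auto intro: wt_integrable_mult)
  moreover have "wt_integrable w (\<lambda>x. \<Sum>j\<in>J. c j * f j x)"
    using insert.prems by (intro wt_integrable_lincomb) auto
  ultimately show ?case using insert by (simp add: wt_integral_add wt_integral_mult)
qed auto

lemma poly_eq_at_ends_of_pderiv_0: "pderiv b = 0 \<Longrightarrow> poly b 1 = poly b (0 :: real)"
  by (auto simp: pderiv_eq_0_iff elim!: degree_eq_zeroE)

context linear_forms
begin

text \<open>Differentiation in x produces the shifts e_j with j \<noteq> k. They act alike on the
  total and on the x-sum, and e_i is the one that adds nothing to the y-sum; convergence after the
  shift e_i thus covers the others.\<close>

lemma region_add_shift: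
  assumes "s + unit_shift i \<in> region i k 0 0 0" "j \<noteq> k"
  shows "s + unit_shift j \<in> region i k 0 0 0"
  using assms ik by (auto simp: region_def split: if_splits)

lemma region_add_shift':
  "s \<in> region i k 0 0 0 \<Longrightarrow> s + unit_shift j \<in> region i k 0 0 0"
  by (auto simp: region_def)

text \<open>Moving a unit of exponent from x or y to a mixed form keeps the total and lowers neither
  partial sum.\<close>

lemma region_exchange:
  assumes "s \<in> region i k 0 0 0" "j \<noteq> i" "j \<noteq> k"
  shows "s - unit_shift i + unit_shift j \<in> region i k 0 0 0"
    and "s - unit_shift k + unit_shift j \<in> region i k 0 0 0"
  using assms ik by (auto simp: region_def)

lemma form_kernel_shift:
  assumes "x \<ge> 1" "y \<ge> 1"
  shows "form_kernel A B (s + unit_shift j) x y = form_kernel A B s x y / complex_of_real (A j * x + B j * y)"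
proof -
  define L where "L l = A l * x + B l * y" for l
  have L: "L j > 0" unfolding L_def by (rule form_pos[OF assms])
  have "(s + unit_shift j) $ l * complex_of_real (ln (L l)) =
      s $ l * complex_of_real (ln (L l)) + (if j = l then complex_of_real (ln (L l)) else 0)" for l
    by (simp add: unit_shift_nth algebra_simps)
  hence "(\<Sum>l\<in>UNIV. (s + unit_shift j) $ l * complex_of_real (ln (L l))) =
      (\<Sum>l\<in>UNIV. s $ l * complex_of_real (ln (L l))) + ln (L j)"
    by (simp add: sum.distrib)
  hence "form_kernel A B (s + unit_shift j) x y =
      exp (- (\<Sum>l\<in>UNIV. s $ l * complex_of_real (ln (L l)))) / exp (complex_of_real (ln (L j)))"
    unfolding form_kernel_def L_def[symmetric] by (simp add: exp_diff[symmetric])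
  also have "exp (complex_of_real (ln (L j))) = complex_of_real (L j)"
    using L by (subst exp_of_real) simp
  finally show ?thesis unfolding form_kernel_def L_def .
qed

lemma form_kernel_unshift:
  assumes "x \<ge> 1" "y \<ge> 1"
  shows "form_kernel A B (s - unit_shift j) x y = form_kernel A B s x y * complex_of_real (A j * x + B j * y)"
  using form_kernel_shift[OF assms, of "s - unit_shift j" j] form_pos[OF assms, of j]
  by (simp add: field_simps del: of_real_add of_real_mult)

text \<open>Differentiation in x stays inside the family of kernels, with one exponent raised by 1
  in each term; the form y drops out because \<open>A k = 0\<close>.\<close>

lemma form_kernel_deriv:
  assumes "x \<ge> 1" "y \<ge> 1"
  shows "((\<lambda>x. form_kernel A B s x y) has_vector_derivative
    - (\<Sum>j\<in>UNIV. (A j * s $ j) * form_kernel A B (s + unit_shift j) x y)) (at x)"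
proof -
  define E where "E x = - (\<Sum>j\<in>UNIV. s $ j * complex_of_real (ln (A j * x + B j * y)))" for x
  define E' where "E' = - (\<Sum>j\<in>UNIV. s $ j * complex_of_real (A j / (A j * x + B j * y)))"
  have "(E has_vector_derivative E') (at x)"
    unfolding E_def E'_def
  proof (intro has_vector_derivative_minus has_vector_derivative_sum has_vector_derivative_mult_right)
    fix j
    have "((\<lambda>x. ln (A j * x + B j * y)) has_real_derivative A j / (A j * x + B j * y)) (at x)"
      using form_pos[OF assms, of j] by (auto intro!: derivative_eq_intros)
    thus "((\<lambda>x. complex_of_real (ln (A j * x + B j * y))) has_vector_derivative
        complex_of_real (A j / (A j * x + B j * y))) (at x)"
      by (intro has_vector_derivative_of_real) (simp add: has_real_derivative_iff_has_vector_derivative)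
  qed
  from field_vector_diff_chain_at[OF this, of exp "exp (E x)"]
  have "((\<lambda>x. exp (E x)) has_vector_derivative (E' * exp (E x))) (at x)"
    by (simp add: o_def DERIV_exp)
  also have "E' * exp (E x) = - (\<Sum>j\<in>UNIV. (A j * s $ j) * form_kernel A B (s + unit_shift j) x y)"
  proof -
    have "form_kernel A B s x y = exp (E x)" unfolding form_kernel_def E_def ..
    thus ?thesis
      by (simp add: form_kernel_shift[OF assms] E'_def sum_distrib_right sum_distrib_left mult_ac)
  qed
  finally show ?thesis unfolding E_def form_kernel_def[symmetric] .
qed

text \<open>The kernel at s is x times the kernel at s + e_i. That factor costs one power, and the
  exponent p > 1 available at s + e_i still leaves the decay \<open>x powr (1 - p)\<close>.\<close>

lemma form_kernel_tendsto_0: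
  assumes s: "s + unit_shift i \<in> region i k 0 0 0" and y: "y \<ge> 1"
  shows "(\<lambda>n. form_kernel A B s (real n) y) \<longlonglongrightarrow> 0"
proof -
  obtain C p q where C: "C > 0" "p > 1" "q > 1" and bound:
    "\<And>x y. x \<ge> 1 \<Longrightarrow> y \<ge> 1 \<Longrightarrow>
       norm (form_kernel A B (s + unit_shift i) x y) \<le> C * (x powr (- p) * y powr (- q))"
    by (rule kernel_bound[OF s], rule that)
  have "eventually (\<lambda>n. norm (form_kernel A B s (real n) y) \<le> C * y powr (- q) * real n powr (1 - p)) sequentially"
    using eventually_ge_at_top[of 1]
  proof eventually_elim
    case (elim n)
    have n: "real n \<ge> 1" using elim by simp
    have "form_kernel A B s (real n) y = form_kernel A B (s + unit_shift i) (real n) y * real n"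
      using form_kernel_unshift[OF n y, of "s + unit_shift i" i] by simp
    hence "norm (form_kernel A B s (real n) y) = norm (form_kernel A B (s + unit_shift i) (real n) y) * real n"
      by (simp add: norm_mult)
    also have "\<dots> \<le> C * (real n powr (- p) * y powr (- q)) * real n"
      using bound[OF n y] by (intro mult_right_mono) auto
    also have "\<dots> = C * y powr (- q) * (real n powr 1 * real n powr (- p))" using n by simp
    also have "real n powr 1 * real n powr (- p) = real n powr (1 - p)"
      unfolding powr_add[symmetric] by simp
    finally show ?case .
  qed
  moreover have "(\<lambda>n. C * y powr (- q) * real n powr (1 - p)) \<longlonglongrightarrow> 0"
    using C by (intro tendsto_mult_right_zero tendsto_neg_powr filterlim_real_sequentially) auto
  ultimately show ?thesis by (rule Lim_null_comparison)
qed

text \<open>For constant b the point s may lie one unit outside the region: the integral and the sum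
  of the undifferentiated kernel then have coefficient 0, and only the boundary value remains. This
  case is what the integration of the derivative of x h_s requires.\<close>

lemma form_kernel_by_parts:
  assumes s: "s + unit_shift i \<in> region i k 0 0 0" and b: "pderiv b = 0 \<or> s \<in> region i k 0 0 0"
    and y: "y \<ge> 1"
  shows "wt_integral (Pol (pderiv b)) (\<lambda>x. form_kernel A B s x y)
      - (\<Sum>j\<in>UNIV. (A j * s $ j) * wt_integral (Pol b) (\<lambda>x. form_kernel A B (s + unit_shift j) x y)) =
    (poly b 1 - poly b 0) * wt_integral Comb (\<lambda>x. form_kernel A B s x y)
      - poly b 1 * wt_integral Point (\<lambda>x. form_kernel A B s x y)"
proof -
  let ?\<phi> = "\<lambda>x. form_kernel A B s x y"
  define \<phi>' where "\<phi>' x = (\<Sum>j\<in>UNIV. (- (A j * s $ j)) * form_kernel A B (s + unit_shift j) x y)" for x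
  \<comment> \<open>For j = k the coefficient is 0; this matters because the kernel at s + e_k may
    fail to be integrable when only s + e_i is known to lie in the region.\<close>
  have int: "- (A j * s $ j) = 0 \<or> wt_integrable (Pol b) (\<lambda>x. form_kernel A B (s + unit_shift j) x y)" for j
    using wt_integrable_kernel[OF region_add_shift[OF s] y] by (cases "j = k") auto
  have deriv: "((\<lambda>x. form_kernel A B s x y) has_vector_derivative \<phi>' x) (at x)" if "x \<ge> 1" for x
    using form_kernel_deriv[OF that y, of s] by (simp add: \<phi>'_def sum_negf)
  have "wt_integral (Pol (pderiv b)) ?\<phi> + wt_integral (Pol b) \<phi>' =
           (poly b 1 - poly b 0) * wt_integral Comb ?\<phi> - poly b 1 * ?\<phi> 1"
  proof (rule wt_integral_by_parts)
    show "continuous_on {1..} \<phi>'"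
      unfolding \<phi>'_def
      by (intro continuous_intros continuous_at_imp_continuous_on ballI
           has_vector_derivative_continuous[OF form_kernel_deriv[OF _ y]]) auto
    show "wt_integrable (Pol b) \<phi>'" unfolding \<phi>'_def
      by (rule wt_integrable_lincomb) (rule int)
    show "wt_integrable (Pol (pderiv b)) ?\<phi>"
      using b wt_integrable_kernel[OF _ y] by (cases "pderiv b = 0") auto
    show "poly b 1 = poly b 0 \<or> wt_integrable Comb ?\<phi>"
      using b wt_integrable_kernel[OF _ y] poly_eq_at_ends_of_pderiv_0 by blast
    show "\<phi>' \<in> borel_measurable borel" unfolding \<phi>'_def by measurable
  qed (use deriv form_kernel_tendsto_0[OF s y] in auto)
  moreover have "wt_integral (Pol b) \<phi>' =
      (\<Sum>j\<in>UNIV. (- (A j * s $ j)) * wt_integral (Pol b) (\<lambda>x. form_kernel A B (s + unit_shift j) x y))"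
    unfolding \<phi>'_def by (rule wt_integral_lincomb) (rule int)
  moreover have "wt_integral Point ?\<phi> = ?\<phi> 1"
    by (rule wt_integral_Point) measurable
  ultimately show ?thesis by (simp add: sum_negf)
qed

lemma kernel_integral_by_parts:
  assumes s: "s \<in> region i k 0 0 0"
  shows "kernel_integral A B (Pol (pderiv b)) w s
      - (\<Sum>j\<in>UNIV. (A j * s $ j) * kernel_integral A B (Pol b) w (s + unit_shift j)) =
    (poly b 1 - poly b 0) * kernel_integral A B Comb w s - poly b 1 * kernel_integral A B Point w s"
proof -
  let ?J = "\<lambda>v s y. wt_integral v (\<lambda>x. form_kernel A B s x y)"
  note int = kernel_integral_eq_pair(3)[OF s, of w]
  note int' = kernel_integral_eq_pair(3)[OF region_add_shift'[OF s], of w]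
  have "wt_integral w (\<lambda>y. ?J (Pol (pderiv b)) s y) =
      wt_integral w (\<lambda>y. (poly b 1 - poly b 0) * ?J Comb s y + ((- poly b 1) * ?J Point s y +
        (\<Sum>j\<in>UNIV. (A j * s $ j) * ?J (Pol b) (s + unit_shift j) y)))"
    by (rule wt_integral_cong)
      (use form_kernel_by_parts[OF region_add_shift'[OF s], of b] s in \<open>simp add: algebra_simps\<close>)
  also have "\<dots> = (poly b 1 - poly b 0) * wt_integral w (?J Comb s) + ((- poly b 1) * wt_integral w (?J Point s) +
      (\<Sum>j\<in>UNIV. (A j * s $ j) * wt_integral w (?J (Pol b) (s + unit_shift j))))"
  proof -
    have i1: "wt_integrable w (\<lambda>y. \<Sum>j\<in>UNIV. (A j * s $ j) * ?J (Pol b) (s + unit_shift j) y)"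
      by (rule wt_integrable_lincomb) (rule disjI2[OF int'])
    note i2 = wt_integrable_mult[OF int[of Point], of "- poly b 1"]
    note i3 = wt_integrable_mult[OF int[of Comb], of "poly b 1 - poly b 0"]
    show ?thesis
      unfolding wt_integral_add[OF i3 wt_integrable_add[OF i2 i1]] wt_integral_add[OF i2 i1]
        wt_integral_mult wt_integral_lincomb[OF disjI2[OF int']] ..
  qed
  finally show ?thesis unfolding kernel_integral_def by simp
qed

text \<open>At x = 1 the form x equals 1, so its exponent is invisible. A point weight is therefore
  continued by mere translation.\<close>

lemma kernel_integral_Point_unshift:
  "kernel_integral A B Point w (s - unit_shift i) = kernel_integral A B Point w s"
  unfolding kernel_integral_def
proof (rule wt_integral_cong)
  fix y :: real assume y: "y \<ge> 1"
  show "wt_integral Point (\<lambda>x. form_kernel A B (s - unit_shift i) x y) =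
      wt_integral Point (\<lambda>x. form_kernel A B s x y)"
    using form_kernel_unshift[of 1 y s i] y by (subst (1 2) wt_integral_Point) (simp_all)
qed

text \<open>The derivative of x h_s is integrated, where x h_s is the kernel at s - e_i; after this
  shift the exponent of x is s_i - 1, which gives the first coefficient.\<close>

lemma kernel_integral_Pol_1:
  assumes s: "s \<in> region i k 0 0 0"
  shows "(s $ i - 1) * kernel_integral A B (Pol 1) w s +
    (\<Sum>j\<in>UNIV - {i,k}. (A j * s $ j) * kernel_integral A B (Pol 1) w (s - unit_shift i + unit_shift j)) =
    kernel_integral A B Point w s"
proof -
  let ?J = "\<lambda>v s y. wt_integral v (\<lambda>x. form_kernel A B s x y)"
  define t where "t = s - unit_shift i"
  have ti: "t + unit_shift i \<in> region i k 0 0 0" using s by (simp add: t_def)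
  have int: "A j * t $ j = 0 \<or> wt_integrable w (?J (Pol 1) (t + unit_shift j))" for j
    using kernel_integral_eq_pair(3)[OF region_add_shift[OF ti], of j w] by (cases "j = k") auto
  have "wt_integral w (?J Point t) =
      wt_integral w (\<lambda>y. \<Sum>j\<in>UNIV. (A j * t $ j) * ?J (Pol 1) (t + unit_shift j) y)"
    by (rule wt_integral_cong)
      (use form_kernel_by_parts[OF ti, of 1] in \<open>simp add: pderiv_1\<close>)
  also have "\<dots> = (\<Sum>j\<in>UNIV. (A j * t $ j) * wt_integral w (?J (Pol 1) (t + unit_shift j)))"
    by (rule wt_integral_lincomb) (rule int)
  finally have "kernel_integral A B Point w t =
      (\<Sum>j\<in>UNIV. (A j * t $ j) * kernel_integral A B (Pol 1) w (t + unit_shift j))"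
    unfolding kernel_integral_def .
  also have "\<dots> = (s $ i - 1) * kernel_integral A B (Pol 1) w s +
      (\<Sum>j\<in>UNIV - {i,k}. (A j * s $ j) * kernel_integral A B (Pol 1) w (t + unit_shift j))"
    unfolding sum_UNIV_split by (simp add: t_def unit_shift_nth)
  finally show ?thesis unfolding t_def kernel_integral_Point_unshift by simp
qed

text \<open>The trivial identity A_j x / L_j + B_j y / L_j = 1, with the factors x and y absorbed
  into the exponents of the forms i and k.\<close>

lemma kernel_integral_exchange:
  assumes s: "s \<in> region i k 0 0 0" and j: "j \<noteq> i" "j \<noteq> k"
  shows "A j * kernel_integral A B v w (s - unit_shift i + unit_shift j) +
    B j * kernel_integral A B v w (s - unit_shift k + unit_shift j) = kernel_integral A B v w s"
proof -
  let ?J = "\<lambda>s y. wt_integral v (\<lambda>x. form_kernel A B s x y)"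
  note R = region_exchange[OF s j]
  note int = wt_integrable_kernel[OF R(1), of _ v] wt_integrable_kernel[OF R(2), of _ v]
    kernel_integral_eq_pair(3)[OF R(1), of w v] kernel_integral_eq_pair(3)[OF R(2), of w v]
  have *: "A j * form_kernel A B (s - unit_shift i + unit_shift j) x y +
    B j * form_kernel A B (s - unit_shift k + unit_shift j) x y = form_kernel A B s x y"
    if xy: "x \<ge> 1" "y \<ge> 1" for x y
  proof -
    have nz: "complex_of_real (A j * x + B j * y) \<noteq> 0"
      using form_pos[OF xy, of j] by (simp del: of_real_add of_real_mult)
    have "A j * form_kernel A B (s - unit_shift i + unit_shift j) x y +
        B j * form_kernel A B (s - unit_shift k + unit_shift j) x y =
        form_kernel A B s x y * complex_of_real (A j * x + B j * y) / complex_of_real (A j * x + B j * y)"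
      unfolding form_kernel_shift[OF xy] form_kernel_unshift[OF xy]
      by (simp add: algebra_simps add_divide_distrib)
    thus ?thesis using nz by simp
  qed
  have "A j * kernel_integral A B v w (s - unit_shift i + unit_shift j) +
      B j * kernel_integral A B v w (s - unit_shift k + unit_shift j) =
    wt_integral w (\<lambda>y. A j * ?J (s - unit_shift i + unit_shift j) y + B j * ?J (s - unit_shift k + unit_shift j) y)"
    unfolding kernel_integral_def using int
    by (simp add: wt_integral_add wt_integral_mult wt_integrable_mult)
  also have "\<dots> = kernel_integral A B v w s"
    unfolding kernel_integral_def
  proof (rule wt_integral_cong)
    fix y :: real assume y: "y \<ge> 1"
    have "A j * ?J (s - unit_shift i + unit_shift j) y + B j * ?J (s - unit_shift k + unit_shift j) y =
      wt_integral v (\<lambda>x. A j * form_kernel A B (s - unit_shift i + unit_shift j) x y +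
        B j * form_kernel A B (s - unit_shift k + unit_shift j) x y)"
      using int y by (simp add: wt_integral_add wt_integral_mult wt_integrable_mult)
    also have "\<dots> = ?J s y" by (rule wt_integral_cong) (rule *[OF _ y])
    finally show "A j * ?J (s - unit_shift i + unit_shift j) y + B j * ?J (s - unit_shift k + unit_shift j) y = ?J s y" .
  qed
  finally show ?thesis .
qed

text \<open>The shifts e_j - e_i of \<open>kernel_integral_Pol_1\<close> leave the x-sum unchanged
  and gain nothing. The exchange relation replaces them by multiples of the integral itself, which
  complete s_i - 1 to the x-sum minus 1, and by shifts e_j - e_k, which raise the x-sum by
  1.\<close>

lemma kernel_integral_Pol_1_reduce:
  assumes s: "s \<in> region i k 0 0 0"
  shows "(sum_except k s - 1) * kernel_integral A B (Pol 1) w s =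
    kernel_integral A B Point w s +
    (\<Sum>j\<in>UNIV - {i,k}. (B j * s $ j) * kernel_integral A B (Pol 1) w (s - unit_shift k + unit_shift j))"
proof -
  let ?I = "kernel_integral A B (Pol 1) w"
  have "(\<Sum>j\<in>UNIV - {i,k}. (A j * s $ j) * ?I (s - unit_shift i + unit_shift j)) =
      (\<Sum>j\<in>UNIV - {i,k}. s $ j * ?I s - (B j * s $ j) * ?I (s - unit_shift k + unit_shift j))"
  proof (rule sum.cong[OF refl])
    fix j assume "j \<in> UNIV - {i,k}"
    hence "A j * ?I (s - unit_shift i + unit_shift j) = ?I s - B j * ?I (s - unit_shift k + unit_shift j)"
      using kernel_integral_exchange[OF s, of j "Pol 1" w] by (simp add: algebra_simps)
    hence "s $ j * (A j * ?I (s - unit_shift i + unit_shift j)) =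
        s $ j * (?I s - B j * ?I (s - unit_shift k + unit_shift j))" by (rule arg_cong)
    thus "(A j * s $ j) * ?I (s - unit_shift i + unit_shift j) =
        s $ j * ?I s - (B j * s $ j) * ?I (s - unit_shift k + unit_shift j)"
      by (simp add: algebra_simps)
  qed
  also have "\<dots> = (sum_except k s - s $ i) * ?I s -
      (\<Sum>j\<in>UNIV - {i,k}. (B j * s $ j) * ?I (s - unit_shift k + unit_shift j))"
    unfolding sum_subtractf sum_distrib_right[symmetric] by (simp add: sum_except_k_split)
  finally have "(s $ i - 1) * ?I s + ((sum_except k s - s $ i) * ?I s -
      (\<Sum>j\<in>UNIV - {i,k}. (B j * s $ j) * ?I (s - unit_shift k + unit_shift j))) =
      kernel_integral A B Point w s"
    using kernel_integral_Pol_1[OF s, of w] by simp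
  thus ?thesis by (simp add: algebra_simps)
qed

text \<open>This is Euler's identity for homogeneous functions in integrated form.\<close>

lemma kernel_integral_Pol_1_Pol_1:
  assumes s: "s \<in> region i k 0 0 0"
  shows "(sum_all s - 2) * kernel_integral A B (Pol 1) (Pol 1) s =
    kernel_integral A B Point (Pol 1) s + kernel_integral A B (Pol 1) Point s"
proof -
  interpret sw: linear_forms B A k i by (rule swapped)
  let ?I = "kernel_integral A B (Pol 1) (Pol 1)"
  have s': "s \<in> region k i 0 0 0" using s by (simp add: region_swap)
  have 1: "(s $ k - 1) * ?I s + (\<Sum>j\<in>UNIV - {i,k}. (B j * s $ j) * ?I (s - unit_shift k + unit_shift j)) =
      kernel_integral A B (Pol 1) Point s"
  proof -
    have "(\<Sum>j\<in>UNIV - {i,k}. (B j * s $ j) * ?I (s - unit_shift k + unit_shift j)) =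
      (\<Sum>j\<in>UNIV - {k,i}. (B j * s $ j) * kernel_integral B A (Pol 1) (Pol 1) (s - unit_shift k + unit_shift j))"
      using region_exchange(2)[OF s] by (intro sum.cong) (auto simp: kernel_integral_swap)
    thus ?thesis using sw.kernel_integral_Pol_1[OF s', of "Pol 1"] s by (simp add: kernel_integral_swap)
  qed
  \<comment> \<open>By the exchange relation the shifted integrals of the x-relation and of the
    y-relation recombine, so that none of them survives in the result.\<close>
  have 2: "(\<Sum>j\<in>UNIV - {i,k}. (A j * s $ j) * ?I (s - unit_shift i + unit_shift j)) +
      (\<Sum>j\<in>UNIV - {i,k}. (B j * s $ j) * ?I (s - unit_shift k + unit_shift j)) =
      (\<Sum>j\<in>UNIV - {i,k}. s $ j) * ?I s"
    unfolding sum.distrib[symmetric] sum_distrib_right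
  proof (rule sum.cong[OF refl])
    fix j assume "j \<in> UNIV - {i,k}"
    hence "s $ j * (A j * ?I (s - unit_shift i + unit_shift j) + B j * ?I (s - unit_shift k + unit_shift j)) =
        s $ j * ?I s"
      using kernel_integral_exchange[OF s, of j "Pol 1" "Pol 1"] by simp
    thus "(A j * s $ j) * ?I (s - unit_shift i + unit_shift j) +
        (B j * s $ j) * ?I (s - unit_shift k + unit_shift j) = s $ j * ?I s"
      by (simp add: algebra_simps)
  qed
  have "(sum_all s - 2) * ?I s =
      (s $ i - 1) * ?I s + (s $ k - 1) * ?I s + (\<Sum>j\<in>UNIV - {i,k}. s $ j) * ?I s"
    by (simp add: sum_all_def sum_UNIV_split algebra_simps)
  thus ?thesis
    unfolding 2[symmetric] 1[symmetric] kernel_integral_Pol_1[OF s, of "Pol 1", symmetric] by simp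
qed

end

section \<open>Bernoulli polynomials\<close>

lemma sum_pderiv: "pderiv (sum f J) = (\<Sum>j\<in>J. pderiv (f j))"
  by (induction J rule: infinite_finite_induct) (auto simp: pderiv_add)

lemma poly_antiderivative: "\<exists>q :: real poly. pderiv q = p"
proof
  have "pderiv (\<Sum>m\<le>degree p. monom (coeff p m / real (Suc m)) (Suc m)) = (\<Sum>m\<le>degree p. monom (coeff p m) m)"
    unfolding sum_pderiv by (intro sum.cong) (auto simp: pderiv_monom)
  thus "pderiv (\<Sum>m\<le>degree p. monom (coeff p m / real (Suc m)) (Suc m)) = p"
    by (simp add: poly_as_sum_of_monoms)
qed

text \<open>Equivalent to vanishing mean over [0, 1], phrased without an integral.\<close>

definition periodic_antiderivative :: "real poly \<Rightarrow> bool" where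
  "periodic_antiderivative p \<longleftrightarrow> (\<exists>r. pderiv r = p \<and> poly r 0 = poly r 1)"

lemma periodic_antiderivativeD:
  assumes "periodic_antiderivative p" "pderiv q = p"
  shows "poly q 1 = poly q 0"
proof -
  from assms obtain r where r: "pderiv r = p" "poly r 0 = poly r 1"
    unfolding periodic_antiderivative_def by blast
  have "pderiv (q - r) = 0" using r assms by (simp add: pderiv_diff)
  from poly_eq_at_ends_of_pderiv_0[OF this] r show ?thesis by simp
qed

text \<open>The constant of integration is free and is chosen to make the mean of the antiderivative
  zero, so that the process can be repeated.\<close>

lemma ex_periodic_antiderivative:
  "\<exists>q. pderiv q = p \<and> periodic_antiderivative q"
proof -
  obtain q where q: "pderiv q = p" using poly_antiderivative by blast
  obtain r where r: "pderiv r = q" using poly_antiderivative by blast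
  define c where "c = poly r 0 - poly r 1"
  have "pderiv (q + [:c:]) = p" using q by (simp add: pderiv_add pderiv_pCons)
  moreover have "pderiv (r + [:0, c:]) = q + [:c:]" using r by (simp add: pderiv_add pderiv_pCons)
  moreover have "poly (r + [:0, c:]) 0 = poly (r + [:0, c:]) 1" by (simp add: c_def)
  ultimately show ?thesis unfolding periodic_antiderivative_def by blast
qed

text \<open>\<open>b n\<close> is the Bernoulli polynomial \<open>B\<^sub>n / n!\<close>.\<close>

definition bernoulli_tower :: "(nat \<Rightarrow> real poly) \<Rightarrow> bool" where
  "bernoulli_tower b \<longleftrightarrow> b 0 = 1 \<and> b 1 = [:- 1 / 2, 1:] \<and> (\<forall>n. pderiv (b (Suc n)) = b n) \<and>
     (\<forall>n. poly (b (n + 2)) 1 = poly (b (n + 2)) 0)"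

lemma ex_bernoulli_tower: "\<exists>b. bernoulli_tower b"
proof -
  have "\<exists>f. \<forall>n. (periodic_antiderivative (f n) \<and> (n = 0 \<longrightarrow> f n = [:- 1 / 2, 1:])) \<and> pderiv (f (Suc n)) = f n"
  proof (rule dependent_nat_choice)
    have "periodic_antiderivative [:- 1 / 2, 1:]"
      unfolding periodic_antiderivative_def
      by (intro exI[of _ "[:0, - 1 / 2, 1 / 2:]"]) (simp add: pderiv_pCons)
    thus "\<exists>p. periodic_antiderivative p \<and> ((0 :: nat) = 0 \<longrightarrow> p = [:- 1 / 2, 1:])" by blast
    show "\<exists>q. (periodic_antiderivative q \<and> (Suc n = 0 \<longrightarrow> q = [:- 1 / 2, 1:])) \<and> pderiv q = p" for p and n :: nat
      using ex_periodic_antiderivative[of p] by auto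
  qed
  then obtain f where f: "\<And>n. periodic_antiderivative (f n)" "f 0 = [:- 1 / 2, 1:]"
    "\<And>n. pderiv (f (Suc n)) = f n" by blast
  \<comment> \<open>The recursive choice starts at level 1, whose end values still differ by 1.
    Equal end values at level n + 2 come from the vanishing mean of level n + 1.\<close>
  define b where "b n = (case n of 0 \<Rightarrow> 1 | Suc m \<Rightarrow> f m)" for n
  have "bernoulli_tower b"
    unfolding bernoulli_tower_def
  proof (intro conjI allI)
    fix n
    show "pderiv (b (Suc n)) = b n"
      using f by (cases n) (auto simp: b_def pderiv_pCons)
    show "poly (b (n + 2)) 1 = poly (b (n + 2)) 0"
      using periodic_antiderivativeD[OF f(1) f(3)] by (simp add: b_def)
  qed (auto simp: b_def f)
  thus ?thesis by blast
qed

section \<open>Local quotients and continuation\<close>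

text \<open>The first two families of hyperplanes of the theorem. The total is left out, since a
  division by a function of it occurs only in the final assembly.\<close>

definition polar_set :: "'n::finite \<Rightarrow> 'n \<Rightarrow> (complex ^ 'n) set" where
  "polar_set i k = {s. sum_except k s - 1 \<in> \<int>\<^sub>\<le>\<^sub>0 \<or> sum_except i s - 1 \<in> \<int>\<^sub>\<le>\<^sub>0}"

lemma closed_polar_set:
  fixes i k :: "'n::finite"
  shows "closed (polar_set i k)"
proof -
  have *: "closed ((\<lambda>s. sum_except l s - 1) -` \<int>\<^sub>\<le>\<^sub>0)" for l :: 'n
    by (intro closed_vimage continuous_intros continuous_on_sum_except) simp
  have "polar_set i k = (\<lambda>s. sum_except k s - 1) -` \<int>\<^sub>\<le>\<^sub>0 \<union> (\<lambda>s. sum_except i s - 1) -` \<int>\<^sub>\<le>\<^sub>0"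
    by (auto simp: polar_set_def)
  also have "closed \<dots>" by (intro closed_Un *)
  finally show ?thesis .
qed

lemma polar_set_swap: "polar_set k i = polar_set i k"
  by (auto simp: polar_set_def)

lemma region_disjoint_polar_set: "s \<in> region i k 0 0 0 \<Longrightarrow> s \<notin> polar_set i k"
proof -
  have "Re z \<le> 1" if "z - 1 \<in> \<int>\<^sub>\<le>\<^sub>0" for z :: complex
  proof -
    from that obtain m where "z - 1 = of_int m" "m \<le> 0" by (elim nonpos_Ints_cases)
    hence "Re (z - 1) \<le> 0" by simp
    thus ?thesis by simp
  qed
  thus "s \<in> region i k 0 0 0 \<Longrightarrow> s \<notin> polar_set i k"
    by (fastforce simp: region_def polar_set_def)
qed

text \<open>On the exceptional set \<open>S\<close> the values of \<open>F\<close> are unconstrained.\<close>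

definition quotient_off :: "(complex ^ 'n) set \<Rightarrow> (complex ^ 'n) set \<Rightarrow> (complex ^ 'n \<Rightarrow> complex) \<Rightarrow> bool" where
  "quotient_off S U F \<longleftrightarrow> open U \<and> (\<forall>p\<in>U. \<exists>V g h. p \<in> V \<and> mv_holomorphic_on g V \<and>
     mv_holomorphic_on h V \<and> (\<forall>z\<in>V - S. h z \<noteq> 0 \<and> F z = g z / h z))"

lemma quotient_offE:
  assumes "quotient_off S U F" "p \<in> U"
  obtains V g h where "p \<in> V" "mv_holomorphic_on g V" "mv_holomorphic_on h V"
    "\<forall>z\<in>V - S. h z \<noteq> 0 \<and> F z = g z / h z"
  using assms unfolding quotient_off_def by meson

lemma quotient_off_subset: "quotient_off S U F \<Longrightarrow> U' \<subseteq> U \<Longrightarrow> open U' \<Longrightarrow> quotient_off S U' F"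
  unfolding quotient_off_def by blast

lemma quotient_off_holomorphic:
  assumes "mv_holomorphic_on F U"
  shows "quotient_off S U F"
  unfolding quotient_off_def
proof (intro conjI ballI)
  show "open U" using assms by (simp add: mv_holomorphic_on_iff)
  fix p assume "p \<in> U"
  thus "\<exists>V g h. p \<in> V \<and> mv_holomorphic_on g V \<and>
     mv_holomorphic_on h V \<and> (\<forall>z\<in>V - S. h z \<noteq> 0 \<and> F z = g z / h z)"
    using assms by (intro exI[of _ U] exI[of _ F] exI[of _ "\<lambda>_. 1"]) (auto simp: mv_holomorphic_on_iff)
qed

lemma quotient_off_add:
  assumes "quotient_off S U F" "quotient_off S U G"
  shows "quotient_off S U (\<lambda>s. F s + G s)"
  unfolding quotient_off_def
proof (intro conjI ballI)
  show "open U" using assms by (simp add: quotient_off_def)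
  fix p assume "p \<in> U"
  obtain V g h where
    F: "p \<in> V" "mv_holomorphic_on g V" "mv_holomorphic_on h V" "\<forall>z\<in>V - S. h z \<noteq> 0 \<and> F z = g z / h z"
    using assms(1) \<open>p \<in> U\<close> unfolding quotient_off_def by meson
  obtain V' g' h' where
    G: "p \<in> V'" "mv_holomorphic_on g' V'" "mv_holomorphic_on h' V'" "\<forall>z\<in>V' - S. h' z \<noteq> 0 \<and> G z = g' z / h' z"
    using assms(2) \<open>p \<in> U\<close> unfolding quotient_off_def by meson
  note * = F G
  show "\<exists>V g h. p \<in> V \<and> mv_holomorphic_on g V \<and>
     mv_holomorphic_on h V \<and> (\<forall>z\<in>V - S. h z \<noteq> 0 \<and> F z + G z = g z / h z)"
  proof (rule exI[of _ "V \<inter> V'"], rule exI[of _ "\<lambda>z. g z * h' z + g' z * h z"],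
      rule exI[of _ "\<lambda>z. h z * h' z"], intro conjI)
    show "\<forall>z\<in>V \<inter> V' - S. h z * h' z \<noteq> 0 \<and> F z + G z = (g z * h' z + g' z * h z) / (h z * h' z)"
      using * by (auto simp: field_simps)
  qed (use * in \<open>auto simp: mv_holomorphic_on_iff intro!: mv_differentiable_add mv_differentiable_mult\<close>)
qed

lemma quotient_off_mult_entire:
  assumes "quotient_off S U F" "\<And>z. mv_differentiable c z"
  shows "quotient_off S U (\<lambda>s. c s * F s)"
  unfolding quotient_off_def
proof (intro conjI ballI)
  show "open U" using assms by (simp add: quotient_off_def)
  fix p assume "p \<in> U"
  then obtain V g h where
    *: "p \<in> V" "mv_holomorphic_on g V" "mv_holomorphic_on h V" "\<forall>z\<in>V - S. h z \<noteq> 0 \<and> F z = g z / h z"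
    using assms unfolding quotient_off_def by meson
  show "\<exists>V g h. p \<in> V \<and> mv_holomorphic_on g V \<and>
     mv_holomorphic_on h V \<and> (\<forall>z\<in>V - S. h z \<noteq> 0 \<and> c z * F z = g z / h z)"
    by (rule exI[of _ V], rule exI[of _ "\<lambda>z. c z * g z"], rule exI[of _ h])
      (use * assms(2) in \<open>auto simp: mv_holomorphic_on_iff intro!: mv_differentiable_mult\<close>)
qed

lemma quotient_off_divide_entire:
  assumes "quotient_off S U F" "\<And>z. mv_differentiable c z" "\<And>z. z \<notin> S \<Longrightarrow> c z \<noteq> 0"
  shows "quotient_off S U (\<lambda>s. F s / c s)"
  unfolding quotient_off_def
proof (intro conjI ballI)
  show "open U" using assms by (simp add: quotient_off_def)
  fix p assume "p \<in> U"
  then obtain V g h where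
    *: "p \<in> V" "mv_holomorphic_on g V" "mv_holomorphic_on h V" "\<forall>z\<in>V - S. h z \<noteq> 0 \<and> F z = g z / h z"
    using assms unfolding quotient_off_def by meson
  show "\<exists>V g h. p \<in> V \<and> mv_holomorphic_on g V \<and>
     mv_holomorphic_on h V \<and> (\<forall>z\<in>V - S. h z \<noteq> 0 \<and> F z / c z = g z / h z)"
    by (rule exI[of _ V], rule exI[of _ g], rule exI[of _ "\<lambda>z. c z * h z"])
      (use * assms(2,3) in \<open>auto simp: mv_holomorphic_on_iff field_simps intro!: mv_differentiable_mult\<close>)
qed

lemma open_translate_vimage: "open U \<Longrightarrow> open {s. s + v \<in> U}" for U :: "'a::real_normed_vector set"
proof -
  have "continuous_on UNIV (\<lambda>s. s + v)" by (intro continuous_intros)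
  thus "open U \<Longrightarrow> open {s. s + v \<in> U}" using open_vimage[of U "\<lambda>s. s + v"] by (simp add: vimage_def)
qed

lemma quotient_off_shift:
  assumes F: "quotient_off S U F" and S: "\<And>s. s + v \<in> S \<Longrightarrow> s \<in> S"
  shows "quotient_off S {s. s + v \<in> U} (\<lambda>s. F (s + v))"
  unfolding quotient_off_def
proof (intro conjI ballI)
  show "open {s. s + v \<in> U}" using F by (intro open_translate_vimage) (simp add: quotient_off_def)
  fix p assume "p \<in> {s. s + v \<in> U}"
  then obtain V g h where
    *: "p + v \<in> V" "mv_holomorphic_on g V" "mv_holomorphic_on h V" "\<forall>z\<in>V - S. h z \<noteq> 0 \<and> F z = g z / h z"
    using F unfolding quotient_off_def mem_Collect_eq by meson
  show "\<exists>V g h. p \<in> V \<and> mv_holomorphic_on g V \<and>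
     mv_holomorphic_on h V \<and> (\<forall>z\<in>V - S. h z \<noteq> 0 \<and> F (z + v) = g z / h z)"
    by (rule exI[of _ "{s. s + v \<in> V}"], rule exI[of _ "\<lambda>s. g (s + v)"], rule exI[of _ "\<lambda>s. h (s + v)"])
      (use * S in \<open>auto simp: mv_holomorphic_on_iff intro!: mv_differentiable_shift open_translate_vimage\<close>)
qed

lemma quotient_off_cong:
  assumes "quotient_off S U F" "\<And>z. z \<in> U - S \<Longrightarrow> F z = G z"
  shows "quotient_off S U G"
  unfolding quotient_off_def
proof (intro conjI ballI)
  show U: "open U" using assms by (simp add: quotient_off_def)
  fix p assume "p \<in> U"
  then obtain V g h where
    *: "p \<in> V" "mv_holomorphic_on g V" "mv_holomorphic_on h V" "\<forall>z\<in>V - S. h z \<noteq> 0 \<and> F z = g z / h z"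
    using assms unfolding quotient_off_def by meson
  show "\<exists>V g h. p \<in> V \<and> mv_holomorphic_on g V \<and>
     mv_holomorphic_on h V \<and> (\<forall>z\<in>V - S. h z \<noteq> 0 \<and> G z = g z / h z)"
    by (rule exI[of _ "V \<inter> U"], rule exI[of _ g], rule exI[of _ h])
      (use * U \<open>p \<in> U\<close> assms(2)[symmetric] in \<open>auto simp: mv_holomorphic_on_iff\<close>)
qed

lemma quotient_off_differentiable:
  assumes F: "quotient_off S U F" and S: "closed S" and z: "z \<in> U" "z \<notin> S"
  shows "mv_differentiable F z"
proof -
  obtain V g h where
    *: "z \<in> V" "mv_holomorphic_on g V" "mv_holomorphic_on h V" "\<forall>z\<in>V - S. h z \<noteq> 0 \<and> F z = g z / h z"
    using F z unfolding quotient_off_def by meson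
  have "mv_differentiable (\<lambda>s. g s / h s) z"
    using * z by (intro mv_differentiable_divide) (auto simp: mv_holomorphic_on_iff)
  thus ?thesis
    by (rule mv_differentiable_cong[of _ _ "V - S"]) (use * S z in \<open>auto simp: mv_holomorphic_on_iff\<close>)
qed

text \<open>Only the values of f in the region of convergence matter, where f is a genuine integral.
  Off the polar set the extension is determined by them; this is
  \<open>quotient_off_region_unique\<close> and is kept out of the definition.\<close>

definition extends_to :: "'n::finite \<Rightarrow> 'n \<Rightarrow> nat \<Rightarrow> nat \<Rightarrow> nat \<Rightarrow> (complex ^ 'n \<Rightarrow> complex) \<Rightarrow> bool" where
  "extends_to i k a b c f \<longleftrightarrow> (\<exists>F. quotient_off (polar_set i k) (region i k a b c) F \<and>
     (\<forall>s\<in>region i k 0 0 0. F s = f s))"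

lemma extends_to_swap: "extends_to k i b a c f \<longleftrightarrow> extends_to i k a b c f"
  by (simp add: extends_to_def polar_set_swap[of k i] region_swap[of k i])

lemma extends_to_mono:
  "extends_to i k a' b' c' f \<Longrightarrow> a \<le> a' \<Longrightarrow> b \<le> b' \<Longrightarrow> c \<le> c' \<Longrightarrow> extends_to i k a b c f"
  unfolding extends_to_def using quotient_off_subset[OF _ region_mono open_region] by blast

lemma extends_to_cong:
  assumes "extends_to i k a b c f" "\<And>s. s \<in> region i k 0 0 0 \<Longrightarrow> f s = g s"
  shows "extends_to i k a b c g"
  using assms unfolding extends_to_def by metis

lemma extends_to_holomorphic:
  "mv_holomorphic_on f (region i k 0 0 0) \<Longrightarrow> extends_to i k 0 0 0 f"
  unfolding extends_to_def using quotient_off_holomorphic by blast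

lemma extends_to_add:
  assumes "extends_to i k a b c f" "extends_to i k a b c g"
  shows "extends_to i k a b c (\<lambda>s. f s + g s)"
proof -
  obtain F G where *: "quotient_off (polar_set i k) (region i k a b c) F" "\<forall>s\<in>region i k 0 0 0. F s = f s"
    "quotient_off (polar_set i k) (region i k a b c) G" "\<forall>s\<in>region i k 0 0 0. G s = g s"
    using assms unfolding extends_to_def by blast
  show ?thesis unfolding extends_to_def
    by (rule exI[of _ "\<lambda>s. F s + G s"]) (use * quotient_off_add in auto)
qed

lemma extends_to_mult_entire:
  assumes "extends_to i k a b c f" "\<And>z. mv_differentiable e z"
  shows "extends_to i k a b c (\<lambda>s. e s * f s)"
proof -
  obtain F where *: "quotient_off (polar_set i k) (region i k a b c) F" "\<forall>s\<in>region i k 0 0 0. F s = f s"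
    using assms unfolding extends_to_def by blast
  show ?thesis unfolding extends_to_def
    by (rule exI[of _ "\<lambda>s. e s * F s"]) (use * quotient_off_mult_entire[OF _ assms(2)] in auto)
qed

lemma extends_to_zero: "extends_to i k a b c (\<lambda>s. 0)"
  unfolding extends_to_def
  by (rule exI[of _ "\<lambda>s. 0"]) (auto intro!: quotient_off_holomorphic simp: mv_holomorphic_on_iff)

lemma extends_to_lincomb:
  assumes "\<And>j. j \<in> J \<Longrightarrow> extends_to i k a b c (f j)" "\<And>j z. mv_differentiable (e j) z"
  shows "extends_to i k a b c (\<lambda>s. \<Sum>j\<in>J. e j s * f j s)"
  using assms(1)
  by (induction J rule: infinite_finite_induct)
    (auto intro!: extends_to_zero extends_to_add extends_to_mult_entire assms(2))

text \<open>The nonpositive integers are stable under subtraction of natural numbers. Hence a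
  continuation translated to the left brings no new hyperplanes.\<close>

lemma polar_set_shift:
  assumes "sum_except k v = of_nat \<alpha>" "sum_except i v = of_nat \<beta>" "s + v \<in> polar_set i k"
  shows "s \<in> polar_set i k"
proof -
  have *: "z - 1 \<in> \<int>\<^sub>\<le>\<^sub>0" if "z + of_nat n - 1 \<in> \<int>\<^sub>\<le>\<^sub>0" for z :: complex and n
  proof -
    have "(z + of_nat n - 1) - of_nat n \<in> \<int>\<^sub>\<le>\<^sub>0" using that by (rule nonpos_Ints_diff_Nats) auto
    thus ?thesis by (simp add: algebra_simps)
  qed
  show ?thesis using assms * by (auto simp: polar_set_def)
qed

text \<open>The source of all progress: a translated function reaches further by the values of the
  three sums at v.\<close>

lemma extends_to_shift:
  assumes f: "extends_to i k a b c f"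
    and v: "sum_except k v = of_nat \<alpha>" "sum_except i v = of_nat \<beta>" "sum_all v = of_nat \<gamma>"
  shows "extends_to i k (a + \<alpha>) (b + \<beta>) (c + \<gamma>) (\<lambda>s. f (s + v))"
proof -
  obtain F where *: "quotient_off (polar_set i k) (region i k a b c) F" "\<forall>s\<in>region i k 0 0 0. F s = f s"
    using f unfolding extends_to_def by blast
  show ?thesis unfolding extends_to_def
  proof (intro exI[of _ "\<lambda>s. F (s + v)"] conjI ballI)
    have "region i k (a + \<alpha>) (b + \<beta>) (c + \<gamma>) = {s. s + v \<in> region i k a b c}"
      using v by (auto simp: region_def)
    thus "quotient_off (polar_set i k) (region i k (a + \<alpha>) (b + \<beta>) (c + \<gamma>)) (\<lambda>s. F (s + v))"
      using quotient_off_shift[OF *(1)] polar_set_shift[OF v(1,2)] by metis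
    fix s assume "s \<in> region i k 0 0 0"
    hence "s + v \<in> region i k 0 0 0" using v by (auto simp: region_def)
    thus "F (s + v) = f (s + v)" using * by blast
  qed
qed

lemma extends_to_divide:
  assumes "extends_to i k a b c f"
  shows "extends_to i k a b c (\<lambda>s. f s / (sum_except k s - 1))"
proof -
  obtain F where *: "quotient_off (polar_set i k) (region i k a b c) F" "\<forall>s\<in>region i k 0 0 0. F s = f s"
    using assms unfolding extends_to_def by blast
  have "quotient_off (polar_set i k) (region i k a b c) (\<lambda>s. F s / (sum_except k s - 1))"
    by (rule quotient_off_divide_entire[OF *(1)])
      (auto simp: polar_set_def intro!: mv_differentiable_diff)
  thus ?thesis unfolding extends_to_def using * by (intro exI[of _ "\<lambda>s. F s / (sum_except k s - 1)"]) auto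
qed

text \<open>The direction (1, ..., 1) raises all three sums. On the complex line through z in this
  direction the region is a half-plane and the polar set is closed and countable, so its complement
  in the half-plane is connected. It contains a smaller half-plane belonging to the region of
  convergence, and the identity theorem carries equality from there to t = 0.\<close>

lemma quotient_off_region_unique:
  fixes i k :: "'n::finite"
  assumes ik: "i \<noteq> k"
    and F: "quotient_off (polar_set i k) (region i k a b c) F"
    and G: "quotient_off (polar_set i k) (region i k a b c) G"
    and eq: "\<And>s. s \<in> region i k 0 0 0 \<Longrightarrow> F s = G s"
    and z: "z \<in> region i k a b c" "z \<notin> polar_set i k"
  shows "F z = G z"
proof -
  define v :: "complex ^ 'n" where "v = (\<chi> j. 1)"
  define n where "n = real CARD('n) - 1"
  have "card {i, k} \<le> CARD('n)" by (intro card_mono) auto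
  hence n: "n > 0" using ik by (simp add: n_def)
  have allv: "sum_all v = complex_of_real (n + 1)" by (simp add: sum_all_def v_def n_def)
  have exv: "sum_except l v = complex_of_real n" for l
    using sum_all_eq[of v l] allv by (simp add: v_def)
  have lin: "sum_except l (z + t *s v) = sum_except l z + t * n" "sum_all (z + t *s v) = sum_all z + t * (n + 1)" for t l
  proof -
    have "sum_except l (t *s v) = t * sum_except l v" "sum_all (t *s v) = t * sum_all v"
      by (simp_all add: sum_except_def sum_all_def sum_distrib_left)
    thus "sum_except l (z + t *s v) = sum_except l z + t * n" "sum_all (z + t *s v) = sum_all z + t * (n + 1)"
      using exv[of l] allv by simp_all
  qed
  define H where "H = {t. z + t *s v \<in> region i k a b c}"
  define P where "P = {t. z + t *s v \<in> polar_set i k}"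
  define H0 where "H0 = {t. z + t *s v \<in> region i k 0 0 0}"
  define m where "m = max ((1 - real a - Re (sum_except k z)) / n)
      (max ((1 - real b - Re (sum_except i z)) / n) ((2 - real c - Re (sum_all z)) / (n + 1)))"
  have H: "H = {t. Re t > m}" unfolding H_def region_def m_def mem_Collect_eq lin using n
    by (auto simp: field_simps)
  define m0 where "m0 = max ((1 - Re (sum_except k z)) / n)
      (max ((1 - Re (sum_except i z)) / n) ((2 - Re (sum_all z)) / (n + 1)))"
  have H0: "H0 = {t. Re t > m0}" unfolding H0_def region_def m0_def mem_Collect_eq lin using n
    by (auto simp: field_simps)
  have cont: "continuous_on UNIV (\<lambda>t. z + t *s v)"
    unfolding vector_scalar_mult_def by (intro continuous_intros continuous_on_vec_lambda)
  have "closed P" unfolding P_def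
    using continuous_closed_preimage[OF cont closed_UNIV closed_polar_set] by (simp add: vimage_def)
  have "P \<subseteq> (\<lambda>q. (q + 1 - sum_except k z) / n) ` \<int>\<^sub>\<le>\<^sub>0 \<union> (\<lambda>q. (q + 1 - sum_except i z) / n) ` \<int>\<^sub>\<le>\<^sub>0"
  proof
    fix t assume "t \<in> P"
    hence "(\<exists>l\<in>{i,k}. sum_except l z + t * n - 1 \<in> \<int>\<^sub>\<le>\<^sub>0)" unfolding P_def polar_set_def mem_Collect_eq lin by blast
    then obtain l where l: "l \<in> {i,k}" "sum_except l z + t * n - 1 \<in> \<int>\<^sub>\<le>\<^sub>0" by blast
    have "t = ((sum_except l z + t * n - 1) + 1 - sum_except l z) / n" using n by simp
    with l show "t \<in> (\<lambda>q. (q + 1 - sum_except k z) / n) ` \<int>\<^sub>\<le>\<^sub>0 \<union> (\<lambda>q. (q + 1 - sum_except i z) / n) ` \<int>\<^sub>\<le>\<^sub>0"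
      by blast
  qed
  moreover have "countable (\<int>\<^sub>\<le>\<^sub>0 :: complex set)"
    by (rule countable_subset[OF nonpos_Ints_subset_Ints countable_int])
  ultimately have P: "countable P" by (meson countable_Un countable_image countable_subset)
  have conv: "convex H" "open H" unfolding H by (auto simp: convex_halfspace_Re_gt open_halfspace_Re_gt)
  have nz: "t \<in> H - P \<Longrightarrow> z + t *s v \<in> region i k a b c \<and> z + t *s v \<notin> polar_set i k" for t
    by (auto simp: H_def P_def)
  have "F (z + 0 *s v) = G (z + 0 *s v)"
  proof (rule analytic_continuation_open[of "H0 \<inter> H" "H - P" "\<lambda>t. F (z + t *s v)" "\<lambda>t. G (z + t *s v)"])
    show "open (H0 \<inter> H)" unfolding H0 H by (intro open_Int open_halfspace_Re_gt)
    show "open (H - P)" using conv \<open>closed P\<close> by auto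
    have "complex_of_real (max m m0 + 1) \<in> H0 \<inter> H" unfolding H0 H by auto
    thus "H0 \<inter> H \<noteq> {}" by blast
    show "connected (H - P)"
      using conv P by (intro connected_open_diff_countable convex_connected) auto
    show "H0 \<inter> H \<subseteq> H - P"
      using region_disjoint_polar_set by (auto simp: H0_def P_def)
    show "(\<lambda>t. F (z + t *s v)) holomorphic_on H - P"
      unfolding holomorphic_on_def
      using quotient_off_differentiable[OF F closed_polar_set] nz
      by (auto intro!: field_differentiable_at_within mv_differentiable_line)
    show "(\<lambda>t. G (z + t *s v)) holomorphic_on H - P"
      unfolding holomorphic_on_def
      using quotient_off_differentiable[OF G closed_polar_set] nz
      by (auto intro!: field_differentiable_at_within mv_differentiable_line)
    show "F (z + t *s v) = G (z + t *s v)" if "t \<in> H0 \<inter> H" for t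
      using that eq by (auto simp: H0_def)
    show "0 \<in> H - P" using z by (auto simp: H_def P_def)
  qed
  thus ?thesis by simp
qed

lemma extends_to_glue:
  fixes i k :: "'n::finite"
  assumes ik: "i \<noteq> k" and f: "\<And>N. extends_to i k N N N f"
  obtains F where "quotient_off (polar_set i k) UNIV F" "\<And>s. s \<in> region i k 0 0 0 \<Longrightarrow> F s = f s"
proof -
  let ?R = "\<lambda>N. region i k N N N"
  from f have "\<forall>N. \<exists>F. quotient_off (polar_set i k) (?R N) F \<and> (\<forall>s\<in>?R 0. F s = f s)"
    unfolding extends_to_def by blast
  then obtain G where G: "\<And>N. quotient_off (polar_set i k) (?R N) (G N)" "\<And>N s. s \<in> ?R 0 \<Longrightarrow> G N s = f s"
    by metis
  have ex: "\<exists>N. s \<in> ?R N" for s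
  proof -
    obtain N where "real N > max (1 - Re (sum_except k s)) (max (1 - Re (sum_except i s)) (2 - Re (sum_all s)))"
      using reals_Archimedean2 by blast
    thus ?thesis by (intro exI[of _ N]) (auto simp: region_def)
  qed
  \<comment> \<open>Minimality makes the chosen index at most any other admissible N, so two
    extensions are always compared on the smaller of the two regions.\<close>
  define F where "F s = G (LEAST N. s \<in> ?R N) s" for s
  have FG: "F s = G N s" if "s \<in> ?R N" "s \<notin> polar_set i k" for s N
  proof -
    define M where "M = (LEAST N. s \<in> ?R N)"
    have M: "s \<in> ?R M" "M \<le> N" using that unfolding M_def by (auto intro: LeastI Least_le)
    have "quotient_off (polar_set i k) (?R M) (G N)"
      by (rule quotient_off_subset[OF G(1) region_mono]) (use M in auto)
    hence "G M s = G N s" using quotient_off_region_unique[OF ik G(1) _ _ M(1) that(2)] G(2) by simp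
    thus ?thesis by (simp add: F_def M_def)
  qed
  show ?thesis
  proof (rule that)
    show "F s = f s" if "s \<in> ?R 0" for s using FG[OF that] G(2)[OF that] region_disjoint_polar_set[OF that] by simp
    show "quotient_off (polar_set i k) UNIV F"
      unfolding quotient_off_def
    proof (intro conjI ballI)
      fix p
      obtain N where N: "p \<in> ?R N" using ex by blast
      have "quotient_off (polar_set i k) (?R N) F"
        by (rule quotient_off_cong[OF G(1)]) (use FG in auto)
      thus "\<exists>V g h. p \<in> V \<and> mv_holomorphic_on g V \<and> mv_holomorphic_on h V \<and>
          (\<forall>z\<in>V - polar_set i k. h z \<noteq> 0 \<and> F z = g z / h z)"
        using N unfolding quotient_off_def by blast
    qed auto
  qed
qed

section \<open>Continuation of the integrals, one step at a time\<close>

context linear_forms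
begin

lemma extends_to_Point_step:
  assumes "extends_to i k a m c (kernel_integral A B Point w)"
  shows "extends_to i k (Suc a) m (Suc c) (kernel_integral A B Point w)"
proof -
  have "extends_to i k (a + 1) (m + 0) (c + 1) (\<lambda>s. kernel_integral A B Point w (s + unit_shift i))"
    by (rule extends_to_shift[OF assms]) (use ik in auto)
  thus ?thesis using kernel_integral_Point_unshift[of w "_ + unit_shift i"] by simp
qed

text \<open>Each step climbs one level of the tower. The equal end values of
  \<open>b (n + 2)\<close> remove the sum over the integers. The middle counter stays, because the
  shift e_i does not change the y-sum.\<close>

lemma extends_to_Pol_Suc_step:
  assumes b: "bernoulli_tower b"
    and Point: "extends_to i k (Suc a) m (Suc c) (kernel_integral A B Point w)"
    and Pol: "extends_to i k a m c (kernel_integral A B (Pol (b (n + 2))) w)"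
  shows "extends_to i k (Suc a) m (Suc c) (kernel_integral A B (Pol (b (n + 1))) w)"
proof -
  let ?I = "kernel_integral A B (Pol (b (n + 2))) w"
  have 1: "extends_to i k (Suc a) m (Suc c) (\<lambda>s. \<Sum>j\<in>UNIV - {k}. (A j * s $ j) * ?I (s + unit_shift j))"
  proof (rule extends_to_lincomb)
    fix j assume j: "j \<in> UNIV - {k}"
    have "extends_to i k (a + 1) (m + (if j = i then 0 else 1)) (c + 1) (\<lambda>s. ?I (s + unit_shift j))"
      by (rule extends_to_shift[OF Pol]) (use j in auto)
    thus "extends_to i k (Suc a) m (Suc c) (\<lambda>s. ?I (s + unit_shift j))"
      by (rule extends_to_mono) auto
  qed (auto intro!: mv_differentiable_mult)
  have 2: "extends_to i k (Suc a) m (Suc c) (\<lambda>s. - poly (b (n + 2)) 1 * kernel_integral A B Point w s)"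
    by (rule extends_to_mult_entire[OF Point]) simp
  show ?thesis
  proof (rule extends_to_cong[OF extends_to_add[OF 1 2]])
    fix s assume s: "s \<in> region i k 0 0 0"
    have "pderiv (b (n + 2)) = b (n + 1)" "poly (b (n + 2)) 1 - poly (b (n + 2)) 0 = 0"
      using b unfolding bernoulli_tower_def by auto
    moreover have "(\<Sum>j\<in>UNIV. (A j * s $ j) * ?I (s + unit_shift j)) =
        (\<Sum>j\<in>UNIV - {k}. (A j * s $ j) * ?I (s + unit_shift j))"
      by (rule sum.mono_neutral_right) auto
    ultimately show "(\<Sum>j\<in>UNIV - {k}. (A j * s $ j) * ?I (s + unit_shift j)) +
        - poly (b (n + 2)) 1 * kernel_integral A B Point w s = kernel_integral A B (Pol (b (n + 1))) w s"
      using kernel_integral_by_parts[OF s, of "b (n + 2)" w] by (simp add: algebra_simps)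
  qed
qed

text \<open>The shifts e_j - e_k preserve the total and the y-sum, so the counter c cannot grow here
  and has to be supplied beforehand by the other variable. The division is the only source of the
  polar hyperplanes.\<close>

lemma extends_to_Pol_1_step:
  assumes Point: "extends_to i k (Suc a) m c (kernel_integral A B Point w)"
    and Pol: "extends_to i k a m c (kernel_integral A B (Pol 1) w)"
  shows "extends_to i k (Suc a) m c (kernel_integral A B (Pol 1) w)"
proof -
  let ?I = "kernel_integral A B (Pol 1) w"
  have "extends_to i k (Suc a) m c (\<lambda>s. \<Sum>j\<in>UNIV - {i,k}. (B j * s $ j) * ?I (s + (unit_shift j - unit_shift k)))"
  proof (rule extends_to_lincomb)
    fix j assume j: "j \<in> UNIV - {i,k}"
    have "extends_to i k (a + 1) (m + 0) (c + 0) (\<lambda>s. ?I (s + (unit_shift j - unit_shift k)))"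
      by (rule extends_to_shift[OF Pol]) (use j ik in auto)
    thus "extends_to i k (Suc a) m c (\<lambda>s. ?I (s + (unit_shift j - unit_shift k)))" by simp
  qed (auto intro!: mv_differentiable_mult)
  from extends_to_divide[OF extends_to_add[OF Point this]] show ?thesis
  proof (rule extends_to_cong)
    fix s assume s: "s \<in> region i k 0 0 0"
    have "sum_except k s \<noteq> 1" using s by (auto simp: region_def)
    thus "(kernel_integral A B Point w s + (\<Sum>j\<in>UNIV - {i,k}. (B j * s $ j) *
        ?I (s + (unit_shift j - unit_shift k)))) / (sum_except k s - 1) = ?I s"
      using kernel_integral_Pol_1_reduce[OF s, of w] by (simp add: divide_eq_eq algebra_simps)
  qed
qed

lemma extends_to_swapped_iff:
  "extends_to k i b a c (kernel_integral B A w v) \<longleftrightarrow> extends_to i k a b c (kernel_integral A B v w)"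
proof -
  have "extends_to i k a b c (kernel_integral B A w v) \<longleftrightarrow> extends_to i k a b c (kernel_integral A B v w)"
    using extends_to_cong kernel_integral_swap by metis
  thus ?thesis unfolding extends_to_swap[of k i b a c] .
qed

text \<open>The first weight is never the constant 1, so the step in x (fact \<open>X\<close>)
  raises the total as well; the second weight may be 1, because its step in y then finds the total
  already raised. The induction is over all levels of the tower at once, since every sawtooth step
  refers to the next level.\<close>

lemma extends_to_kernel_integral:
  assumes b: "bernoulli_tower b"
  shows "v = Point \<or> (\<exists>n. v = Pol (b (n + 1))) \<Longrightarrow> w = Point \<or> (\<exists>n. w = Pol (b n)) \<Longrightarrow>
    extends_to i k N N N (kernel_integral A B v w)"
proof (induction N arbitrary: v w)
  case 0
  show ?case by (rule extends_to_holomorphic[OF kernel_integral_holomorphic])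
next
  case (Suc N)
  interpret sw: linear_forms B A k i by (rule swapped)
  have b0: "b 0 = 1" using b by (simp add: bernoulli_tower_def)
  define V W where "V = {v. v = Point \<or> (\<exists>n. v = Pol (b (n + 1)))}" and "W = {w. w = Point \<or> (\<exists>n. w = Pol (b n))}"
  have IH: "extends_to i k N N N (kernel_integral A B v w)" if "v \<in> V" "w \<in> W" for v w
    using Suc.IH that unfolding V_def W_def by auto
  have X: "extends_to i k (Suc N) N (Suc N) (kernel_integral A B v w)" if v: "v \<in> V" and w: "w \<in> W" for v w
  proof -
    have P: "extends_to i k (Suc N) N (Suc N) (kernel_integral A B Point w)"
      by (rule extends_to_Point_step[OF IH[OF _ w]]) (simp add: V_def)
    show ?thesis
    proof (cases "v = Point")
      case False
      then obtain n where n: "v = Pol (b (n + 1))" using v by (auto simp: V_def)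
      show ?thesis unfolding n
        by (rule extends_to_Pol_Suc_step[OF b P IH[OF _ w]]) (auto simp: V_def intro!: exI[of _ "n + 1"])
    qed (simp add: P)
  qed
  have X': "extends_to k i N (Suc N) (Suc N) (kernel_integral B A w v)" if "v \<in> V" "w \<in> W" for v w
    using X[OF that] by (simp add: extends_to_swapped_iff)
  have v: "v \<in> V" and w: "w \<in> W" using Suc.prems unfolding V_def W_def by auto
  have P: "extends_to k i (Suc N) (Suc N) (Suc N) (kernel_integral B A Point v)"
    by (rule extends_to_mono[OF sw.extends_to_Point_step[OF X'[OF v]]]) (auto simp: W_def)
  have "extends_to k i (Suc N) (Suc N) (Suc N) (kernel_integral B A w v)"
  proof (cases "w = Point")
    case False
    then obtain n where n: "w = Pol (b n)" using w by (auto simp: W_def)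
    show ?thesis
    proof (cases n)
      case 0
      have "Pol 1 \<in> W" using b0 by (auto simp: W_def intro!: exI[of _ 0])
      thus ?thesis unfolding n 0 b0 by (intro sw.extends_to_Pol_1_step P X' v)
    next
      case (Suc n')
      \<comment> \<open>The counter of the total is lowered to N on purpose: the sawtooth step in y
        raises it again.\<close>
      have "extends_to k i N (Suc N) N (kernel_integral B A (Pol (b (n' + 2))) v)"
        by (rule extends_to_mono[OF X'[OF v]]) (auto simp: W_def)
      thus ?thesis using sw.extends_to_Pol_Suc_step[OF b P] unfolding n Suc by simp
    qed
  qed (simp add: P)
  thus ?case by (simp add: extends_to_swapped_iff)
qed

lemma extends_to_kernel_integral':
  assumes b: "bernoulli_tower b"
    and "v = Point \<or> (\<exists>n. v = Pol (b n))" "w = Point \<or> (\<exists>n. w = Pol (b (n + 1)))"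
  shows "extends_to i k N N N (kernel_integral A B v w)"
  using linear_forms.extends_to_kernel_integral[OF swapped b assms(3,2)]
  by (simp add: extends_to_swapped_iff)

section \<open>From sums to integrals\<close>

lemma kernel_integral_Comb:
  assumes s: "s \<in> region i k 0 0 0"
  shows "kernel_integral A B Comb w s = kernel_integral A B (Pol 1) w s + 1 / 2 * kernel_integral A B Point w s
    + (\<Sum>j\<in>UNIV. (- (A j * s $ j)) * kernel_integral A B (Pol [:- 1 / 2, 1:]) w (s + unit_shift j))"
  using kernel_integral_by_parts[OF s, of "[:- 1 / 2, 1:]" w]
  by (simp add: pderiv_pCons sum_negf one_pCons algebra_simps)

text \<open>By Euler--Maclaurin the difference involves only point and sawtooth weights in x. The
  plain integral is set apart, because paired with a second plain integral it would bring in the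
  hyperplane of the total.\<close>

lemma extends_to_Comb_diff:
  assumes "\<And>v. v = Point \<or> v = Pol [:- 1 / 2, 1:] \<Longrightarrow> extends_to i k N N N (kernel_integral A B v w)"
  shows "extends_to i k N N N (\<lambda>s. kernel_integral A B Comb w s - kernel_integral A B (Pol 1) w s)"
proof -
  let ?I = "kernel_integral A B (Pol [:- 1 / 2, 1:]) w"
  have 1: "extends_to i k N N N (\<lambda>s. 1 / 2 * kernel_integral A B Point w s)"
    by (rule extends_to_mult_entire) (auto intro: assms)
  have 2: "extends_to i k N N N (\<lambda>s. \<Sum>j\<in>UNIV. (- (A j * s $ j)) * ?I (s + unit_shift j))"
  proof (rule extends_to_lincomb)
    fix j
    have "extends_to i k (N + (if j = k then 0 else 1)) (N + (if j = i then 0 else 1)) (N + 1) (\<lambda>s. ?I (s + unit_shift j))"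
      by (rule extends_to_shift[OF assms]) auto
    thus "extends_to i k N N N (\<lambda>s. ?I (s + unit_shift j))" by (rule extends_to_mono) auto
  qed (intro mv_differentiable_mult mv_differentiable_uminus mv_differentiable_const mv_differentiable_nth)
  show ?thesis
    by (rule extends_to_cong[OF extends_to_add[OF 1 2]]) (simp add: kernel_integral_Comb)
qed

text \<open>The difference is split at the pair (\<open>Pol 1\<close>, \<open>Comb\<close>): first
  the weight in x is changed, then the weight in y. The first part needs point and sawtooth weights
  paired with \<open>Comb\<close>, which the one-variable result in y reduces to integrals already
  continued.\<close>

lemma extends_to_Comb_Comb_diff:
  "extends_to i k N N N (\<lambda>s. kernel_integral A B Comb Comb s - kernel_integral A B (Pol 1) (Pol 1) s)"
proof -
  obtain b where b: "bernoulli_tower b" using ex_bernoulli_tower by blast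
  have b01: "b 0 = 1" "b (0 + 1) = [:- 1 / 2, 1:]" using b by (auto simp: bernoulli_tower_def)
  have base: "extends_to i k N N N (kernel_integral A B v w)"
    if "v = Point \<or> v = Pol [:- 1 / 2, 1:]" "w = Point \<or> w = Pol 1 \<or> w = Pol [:- 1 / 2, 1:]" for v w
  proof (rule extends_to_kernel_integral[OF b])
    show "v = Point \<or> (\<exists>n. v = Pol (b (n + 1)))" "w = Point \<or> (\<exists>n. w = Pol (b n))"
      using that b01 by metis+
  qed
  have base': "extends_to i k N N N (kernel_integral A B (Pol 1) w)"
    if "w = Point \<or> w = Pol [:- 1 / 2, 1:]" for w
  proof (rule extends_to_kernel_integral'[OF b])
    show "w = Point \<or> (\<exists>n. w = Pol (b (n + 1)))" "Pol 1 = Point \<or> (\<exists>n. Pol 1 = Pol (b n))"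
      using that b01 by metis+
  qed
  have row: "extends_to i k N N N (\<lambda>s. kernel_integral A B v Comb s - kernel_integral A B v (Pol 1) s)"
    if "\<And>w. w = Point \<or> w = Pol [:- 1 / 2, 1:] \<Longrightarrow> extends_to i k N N N (kernel_integral A B v w)" for v
  proof -
    interpret sw: linear_forms B A k i by (rule swapped)
    have "extends_to k i N N N (\<lambda>s. kernel_integral B A Comb v s - kernel_integral B A (Pol 1) v s)"
      by (rule sw.extends_to_Comb_diff) (use that in \<open>simp add: extends_to_swapped_iff\<close>)
    hence "extends_to i k N N N (\<lambda>s. kernel_integral B A Comb v s - kernel_integral B A (Pol 1) v s)"
      by (simp add: extends_to_swap)
    thus ?thesis by (rule extends_to_cong) (simp add: kernel_integral_swap)
  qed
  have "extends_to i k N N N (kernel_integral A B v Comb)" if v: "v = Point \<or> v = Pol [:- 1 / 2, 1:]" for v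
  proof -
    have "extends_to i k N N N (kernel_integral A B v (Pol 1))" using base v by blast
    from extends_to_add[OF row[OF base[OF v]] this] show ?thesis by auto
  qed
  from extends_to_add[OF extends_to_Comb_diff[OF this] row[OF base']]
  show ?thesis by simp
qed

lemma extends_to_Pol_1_Pol_1:
  "extends_to i k N N N (\<lambda>s. (sum_all s - 2) * kernel_integral A B (Pol 1) (Pol 1) s)"
proof -
  obtain b where b: "bernoulli_tower b" using ex_bernoulli_tower by blast
  have b0: "Pol 1 = Pol (b 0)" using b by (simp add: bernoulli_tower_def)
  have "extends_to i k N N N (kernel_integral A B Point (Pol 1))"
    by (rule extends_to_kernel_integral[OF b]) (use b0 in auto)
  moreover have "extends_to i k N N N (kernel_integral A B (Pol 1) Point)"
    by (rule extends_to_kernel_integral'[OF b]) (use b0 in auto)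
  ultimately have "extends_to i k N N N
      (\<lambda>s. kernel_integral A B Point (Pol 1) s + kernel_integral A B (Pol 1) Point s)"
    by (rule extends_to_add)
  thus ?thesis by (rule extends_to_cong) (simp add: kernel_integral_Pol_1_Pol_1)
qed

text \<open>On the unit ball about p both partial sums are bounded, so only finitely many polar
  hyperplanes meet it; P is a finite product of equations of polar hyperplanes that includes all of
  these.\<close>

lemma ex_local_polar_polynomial:
  obtains P where "\<And>z. mv_differentiable P z" "\<And>z. P z = 0 \<Longrightarrow> z \<in> polar_set i k"
    "\<And>z. z \<in> ball p 1 \<Longrightarrow> z \<in> polar_set i k \<Longrightarrow> P z = 0"
proof -
  have bd: "\<exists>M. \<forall>z\<in>cball p 1. norm (sum_except l z - 1) \<le> M" for l
  proof -
    have "compact ((\<lambda>z. sum_except l z - 1) ` cball p 1)"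
      by (intro compact_continuous_image continuous_intros continuous_on_sum_except) auto
    thus ?thesis using compact_imp_bounded bounded_iff by (metis imageI)
  qed
  obtain M M' where M: "\<And>z. z \<in> cball p 1 \<Longrightarrow> norm (sum_except k z - 1) \<le> M"
    "\<And>z. z \<in> cball p 1 \<Longrightarrow> norm (sum_except i z - 1) \<le> M'" using bd[of k] bd[of i] by blast
  obtain N :: nat where N: "real N > max M M'" using reals_Archimedean2 by blast
  define P where "P z = (\<Prod>l<N. (sum_except k z - 1 + of_nat l) * (sum_except i z - 1 + of_nat l))" for z
  have neg: "\<exists>l<N. q + of_nat l = 0" if "q \<in> \<int>\<^sub>\<le>\<^sub>0" "norm q \<le> max M M'" for q :: complex
  proof -
    from that obtain n where n: "q = - of_nat n" by (elim nonpos_Ints_cases')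
    thus ?thesis using that N by (intro exI[of _ n]) auto
  qed
  show ?thesis
  proof (rule that[of P])
    show "mv_differentiable P z" for z unfolding P_def
      by (intro mv_differentiable_prod mv_differentiable_mult mv_differentiable_add mv_differentiable_diff) auto
    show "z \<in> polar_set i k" if "P z = 0" for z
    proof -
      from that obtain l where "sum_except k z - 1 = - of_nat l \<or> sum_except i z - 1 = - of_nat l"
        unfolding P_def by (auto simp: add_eq_0_iff2)
      thus ?thesis unfolding polar_set_def by auto
    qed
    show "P z = 0" if z: "z \<in> ball p 1" "z \<in> polar_set i k" for z
    proof -
      have "norm (sum_except k z - 1) \<le> max M M'" "norm (sum_except i z - 1) \<le> max M M'"
        using M[of z] z(1) by (auto simp: le_max_iff_disj)
      hence "\<exists>l<N. (sum_except k z - 1 + of_nat l) * (sum_except i z - 1 + of_nat l) = 0"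
        using z(2) neg unfolding polar_set_def by (auto simp: mult_eq_0_iff)
      thus ?thesis unfolding P_def by (auto simp: prod_zero_iff)
    qed
  qed
qed

text \<open>Moving in the direction \<open>\<i> (1, \<dots>, 1)\<close> makes the three linear forms non-real.\<close>

lemma ex_nearby_regular:
  assumes "e > 0"
  obtains z where "z \<in> ball p e" "z \<notin> polar_set i k" "sum_all z \<noteq> 2"
proof -
  define v :: "complex ^ 'n" where "v = (\<chi> j. \<i>)"
  define n where "n = real CARD('n) - 1"
  have "card {i, k} \<le> CARD('n)" by (intro card_mono) auto
  hence n: "n > 0" using ik by (simp add: n_def)
  have allv: "sum_all v = \<i> * complex_of_real (n + 1)" by (simp add: sum_all_def v_def n_def)
  have exv: "sum_except l v = \<i> * complex_of_real n" for l
    using sum_all_eq[of v l] allv by (simp add: v_def algebra_simps)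
  define d where "d = e / (norm v + 1)"
  have d: "d > 0" using assms by (simp add: d_def add_nonneg_pos)
  define bad where "bad = {- Im (sum_except k p) / n, - Im (sum_except i p) / n, - Im (sum_all p) / (n + 1)}"
  have "infinite {0<..<d}" using d by (simp add: infinite_Ioo)
  then obtain t where t: "0 < t" "t < d" "t \<notin> bad"
    by (metis bad_def finite.emptyI finite_insert finite_subset greaterThanLessThan_iff subsetI)
  have scale: "sum_except l (p + t *\<^sub>R v) = sum_except l p + t * sum_except l v"
    "sum_all (p + t *\<^sub>R v) = sum_all p + t * sum_all v" for l
    by (simp_all add: sum_except_def sum_all_def sum.distrib sum_distrib_left scaleR_conv_of_real[where 'a = complex])
  have im: "Im (sum_except k (p + t *\<^sub>R v)) \<noteq> 0" "Im (sum_except i (p + t *\<^sub>R v)) \<noteq> 0"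
    "Im (sum_all (p + t *\<^sub>R v)) \<noteq> 0"
    using t(3) n unfolding scale allv exv bad_def by (auto simp: field_simps)
  show ?thesis
  proof (rule that)
    have "t * norm v < d * (norm v + 1)"
      using t d by (intro mult_less_le_imp_less mult_strict_mono) (auto intro: add_nonneg_pos)
    also have "d * (norm v + 1) = e"
    proof -
      have "norm v + 1 \<noteq> 0" using norm_ge_zero[of v] by linarith
      thus ?thesis by (simp add: d_def)
    qed
    finally show "p + t *\<^sub>R v \<in> ball p e" using t by (simp add: dist_norm)
    have "Im z = 0" if "z - 1 \<in> \<int>\<^sub>\<le>\<^sub>0" for z :: complex
    proof -
      from that obtain m where "z - 1 = of_int m" "m \<le> 0" by (elim nonpos_Ints_cases)
      hence "Im (z - 1) = 0" by simp
      thus ?thesis by simp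
    qed
    thus "p + t *\<^sub>R v \<notin> polar_set i k" using im(1,2) by (auto simp: polar_set_def simp del: sum_except_add)
    show "sum_all (p + t *\<^sub>R v) \<noteq> 2" using im(3) by (auto simp del: sum_all_add)
  qed
qed

theorem double_zeta_continuation:
  obtains F where "mv_meromorphic_on F UNIV"
    "\<And>s. s \<in> region i k 0 0 0 \<Longrightarrow> F s = kernel_integral A B Comb Comb s"
    "mv_singularities F \<subseteq> polar_set i k \<union> {s. sum_all s = 2}"
proof -
  let ?S = "polar_set i k"
  obtain F0 where F0: "quotient_off ?S UNIV F0"
    "\<And>s. s \<in> region i k 0 0 0 \<Longrightarrow> F0 s = kernel_integral A B Comb Comb s - kernel_integral A B (Pol 1) (Pol 1) s"
    by (rule extends_to_glue[OF ik extends_to_Comb_Comb_diff], rule that)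
  obtain F1 where F1: "quotient_off ?S UNIV F1"
    "\<And>s. s \<in> region i k 0 0 0 \<Longrightarrow> F1 s = (sum_all s - 2) * kernel_integral A B (Pol 1) (Pol 1) s"
    by (rule extends_to_glue[OF ik extends_to_Pol_1_Pol_1], rule that)
  \<comment> \<open>On the hyperplane of the total the division by 0 gives 0 and the value of F is
    arbitrary there; it belongs to the permitted singular set, and the denominator h below vanishes
    on it.\<close>
  define F where "F s = F0 s + F1 s / (sum_all s - 2)" for s
  show ?thesis
  proof (rule that[of F])
    fix s assume s: "s \<in> region i k 0 0 0"
    have "sum_all s \<noteq> 2" using s by (auto simp: region_def)
    thus "F s = kernel_integral A B Comb Comb s" unfolding F_def F0(2)[OF s] F1(2)[OF s] by simp
  next
    show "mv_singularities F \<subseteq> ?S \<union> {s. sum_all s = 2}"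
    proof
      fix p assume p: "p \<in> mv_singularities F"
      show "p \<in> ?S \<union> {s. sum_all s = 2}"
      proof (rule ccontr)
        assume np: "p \<notin> ?S \<union> {s. sum_all s = 2}"
        have "closed {s :: complex ^ 'n. sum_all s = 2}"
          by (intro closed_Collect_eq continuous_on_sum_all continuous_intros)
        hence "open (- (?S \<union> {s. sum_all s = 2}))"
          using closed_polar_set[of i k] by (intro open_Compl closed_Un)
        moreover have "mv_differentiable F z" if "z \<in> - (?S \<union> {s. sum_all s = 2})" for z
          unfolding F_def using that
          by (intro mv_differentiable_add mv_differentiable_divide mv_differentiable_diff
              quotient_off_differentiable[OF F0(1) closed_polar_set] quotient_off_differentiable[OF F1(1) closed_polar_set]) auto
        ultimately have "mv_holomorphic_on F (- (?S \<union> {s. sum_all s = 2}))"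
          unfolding mv_holomorphic_on_iff by (intro conjI ballI)
        moreover have "p \<in> - (?S \<union> {s. sum_all s = 2})" using np by simp
        ultimately have "\<exists>U. p \<in> U \<and> mv_holomorphic_on F U" by (intro exI conjI)
        with p[unfolded mv_singularities_def mem_Collect_eq] show False by (rule notE)
      qed
    qed
  next
    show "mv_meromorphic_on F UNIV" unfolding mv_meromorphic_on_def
    proof (intro conjI ballI)
      fix p :: "complex ^ 'n"
      obtain V0 g0 h0 where 0: "p \<in> V0" "mv_holomorphic_on g0 V0" "mv_holomorphic_on h0 V0"
        "\<forall>z\<in>V0 - ?S. h0 z \<noteq> 0 \<and> F0 z = g0 z / h0 z"
        by (rule quotient_offE[OF F0(1) UNIV_I], rule that)
      obtain V1 g1 h1 where 1: "p \<in> V1" "mv_holomorphic_on g1 V1" "mv_holomorphic_on h1 V1"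
        "\<forall>z\<in>V1 - ?S. h1 z \<noteq> 0 \<and> F1 z = g1 z / h1 z"
        by (rule quotient_offE[OF F1(1) UNIV_I], rule that)
      obtain P where P: "\<And>z. mv_differentiable P z" "\<And>z. P z = 0 \<Longrightarrow> z \<in> ?S"
        "\<And>z. z \<in> ball p 1 \<Longrightarrow> z \<in> ?S \<Longrightarrow> P z = 0"
        by (rule ex_local_polar_polynomial, rule that)
      have "open (V0 \<inter> V1)" using 0 1 by (auto simp: mv_holomorphic_on_iff)
      then obtain e where e: "e > 0" "ball p e \<subseteq> V0 \<inter> V1" using 0 1 openE[of "V0 \<inter> V1" p] by blast
      define U where "U = ball p (min e 1)"
      have U: "U \<subseteq> V0" "U \<subseteq> V1" "U \<subseteq> ball p 1" using e unfolding U_def by auto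
      \<comment> \<open>Meromorphy prescribes F wherever the denominator is nonzero, whereas nothing
        is known of F0 and F1 on the polar set. The common factor P cancels in the quotient and
        makes h vanish there.\<close>
      define g where "g z = (g0 z * h1 z * (sum_all z - 2) + g1 z * h0 z) * P z" for z
      define h where "h z = h0 z * h1 z * (sum_all z - 2) * P z" for z
      have hol: "mv_holomorphic_on g0 U" "mv_holomorphic_on h0 U" "mv_holomorphic_on g1 U" "mv_holomorphic_on h1 U"
        using 0 1 U by (auto intro: mv_holomorphic_on_subset simp: U_def)
      obtain z0 where z0: "z0 \<in> U" "z0 \<notin> ?S" "sum_all z0 \<noteq> 2"
        unfolding U_def by (rule ex_nearby_regular[of "min e 1" p]) (use e in auto)
      show "\<exists>U g h. p \<in> U \<and> U \<subseteq> UNIV \<and> connected U \<and> mv_holomorphic_on g U \<and> mv_holomorphic_on h U \<and>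
          (\<exists>z\<in>U. h z \<noteq> 0) \<and> (\<forall>z\<in>U. h z \<noteq> 0 \<longrightarrow> F z = g z / h z)"
      proof (rule exI[of _ U], rule exI[of _ g], rule exI[of _ h], intro conjI ballI impI)
        show "p \<in> U" "connected U" using e by (auto simp: U_def)
        show "mv_holomorphic_on g U" "mv_holomorphic_on h U"
          using hol P(1) unfolding mv_holomorphic_on_iff g_def h_def
          by (auto intro!: mv_differentiable_mult mv_differentiable_add mv_differentiable_diff)
        show "\<exists>z\<in>U. h z \<noteq> 0"
          using z0 0(4) 1(4) U P(2) unfolding h_def by (intro bexI[of _ z0]) auto
        fix z assume z: "z \<in> U" "h z \<noteq> 0"
        hence nS: "z \<notin> ?S" using P(3) U(3) unfolding h_def by auto
        hence "h0 z \<noteq> 0" "F0 z = g0 z / h0 z" "h1 z \<noteq> 0" "F1 z = g1 z / h1 z"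
          using 0(4) 1(4) U z(1) by auto
        moreover have "a / x + b / y / t = (a * y * t + b * x) * q / (x * y * t * q)"
          if "x * y * t * q \<noteq> 0" for a b x y t q :: complex
          using that by (simp add: field_simps)
        ultimately show "F z = g z / h z" using z(2) unfolding F_def g_def h_def by metis
      qed auto
    qed auto
  qed
qed

end

section \<open>Necessary conditions for absolute convergence\<close>

lemma summable_on_powr_nat_imp:
  assumes "(\<lambda>m::nat. real m powr a) summable_on {1..}"
  shows "a < -1"
proof -
  have "(\<lambda>m::nat. real m powr a) summable_on UNIV"
    by (rule summable_on_cong_neutral[THEN iffD1, OF _ _ _ assms]) (auto simp: Suc_le_eq)
  hence "summable (\<lambda>m. real m powr a)" by (subst (asm) summable_on_UNIV_nonneg_real_iff) auto
  thus ?thesis by (simp add: summable_real_powr_iff)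
qed

lemma summable_on_Times_swap:
  "(\<lambda>(x, y). f x y) summable_on A \<times> B \<Longrightarrow> (\<lambda>(y, x). f x y) summable_on B \<times> A"
  by (rule summable_on_reindex_bij_witness[of _ prod.swap prod.swap, THEN iffD1]) auto

context linear_forms
begin

text \<open>\<open>d j\<close> is the order of growth of the form j in terms of x at the points
  considered, and \<open>K j\<close> bounds the deviation of its logarithm.\<close>

lemma norm_form_kernel_ge:
  assumes "x \<ge> 1" and "\<And>j. \<bar>ln (A j * x + B j * y) - d j * ln x\<bar> \<le> K j"
  shows "exp (- (\<Sum>j\<in>UNIV. \<bar>Re (s $ j)\<bar> * K j)) * x powr (- (\<Sum>j\<in>UNIV. Re (s $ j) * d j)) \<le>
    norm (form_kernel A B s x y)"
proof -
  have "Re (s $ j) * ln (A j * x + B j * y) \<le> \<bar>Re (s $ j)\<bar> * K j + Re (s $ j) * d j * ln x" for j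
  proof -
    have "Re (s $ j) * (ln (A j * x + B j * y) - d j * ln x) \<le> \<bar>Re (s $ j)\<bar> * \<bar>ln (A j * x + B j * y) - d j * ln x\<bar>"
      by (metis abs_ge_self abs_mult)
    also have "\<dots> \<le> \<bar>Re (s $ j)\<bar> * K j" by (intro mult_left_mono assms) auto
    finally show ?thesis by (simp add: algebra_simps)
  qed
  hence "(\<Sum>j\<in>UNIV. Re (s $ j) * ln (A j * x + B j * y)) \<le>
      (\<Sum>j\<in>UNIV. \<bar>Re (s $ j)\<bar> * K j + Re (s $ j) * d j * ln x)" by (rule sum_mono)
  also have "\<dots> = (\<Sum>j\<in>UNIV. \<bar>Re (s $ j)\<bar> * K j) + (\<Sum>j\<in>UNIV. Re (s $ j) * d j) * ln x"
    by (simp add: sum.distrib sum_distrib_right)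
  finally have "exp (- (\<Sum>j\<in>UNIV. \<bar>Re (s $ j)\<bar> * K j) - (\<Sum>j\<in>UNIV. Re (s $ j) * d j) * ln x) \<le>
      norm (form_kernel A B s x y)"
    unfolding norm_form_kernel by simp
  moreover have "exp (- (\<Sum>j\<in>UNIV. \<bar>Re (s $ j)\<bar> * K j) - (\<Sum>j\<in>UNIV. Re (s $ j) * d j) * ln x) =
      exp (- (\<Sum>j\<in>UNIV. \<bar>Re (s $ j)\<bar> * K j)) * x powr (- (\<Sum>j\<in>UNIV. Re (s $ j) * d j))"
    using assms(1) by (simp add: powr_def exp_diff exp_minus divide_inverse)
  ultimately show ?thesis by simp
qed

text \<open>The row n = 1 is enough. There the form y is 1 and each form containing x is comparable
  to m, so the terms are at least a constant times
  \<open>real m powr (- Re (sum_except k s))\<close>.\<close>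

lemma summable_imp_sum_except:
  assumes "(\<lambda>(m, n). norm (form_kernel A B s (real m) (real n))) summable_on ({1..} \<times> {1..})"
  shows "Re (sum_except k s) > 1"
proof -
  define K where "K j = \<bar>ln (A j)\<bar> + \<bar>ln (A j + B j)\<bar>" for j
  define d :: "'n \<Rightarrow> real" where "d j = (if j = k then 0 else 1)" for j
  define c where "c = exp (- (\<Sum>j\<in>UNIV. \<bar>Re (s $ j)\<bar> * K j))"
  have d: "(\<Sum>j\<in>UNIV. Re (s $ j) * d j) = Re (sum_except k s)"
    unfolding sum_except_def Re_sum by (rule sum.mono_neutral_cong_right) (auto simp: d_def)
  have "(\<lambda>m::nat. norm (form_kernel A B s (real m) 1)) summable_on {1..}"
  proof -
    have "(\<lambda>(n, m). norm (form_kernel A B s (real m) (real n))) summable_on ({1..} \<times> {1..})"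
      by (rule summable_on_Times_swap[OF assms])
    from summable_on_SigmaD1[OF this, of 1] show ?thesis by simp
  qed
  hence "(\<lambda>m::nat. c * real m powr (- Re (sum_except k s))) summable_on {1..}"
  proof (rule summable_on_comparison_test)
    fix m :: nat assume "m \<in> {1..}"
    hence m: "real m \<ge> 1" by simp
    have "\<bar>ln (A j * real m + B j * 1) - d j * ln (real m)\<bar> \<le> K j" for j
    proof (cases "j = k")
      case False
      have A: "A j > 0" using False coeffs_pos[of j] by (cases "j = i") auto
      have pos: "A j * real m > 0" using A m by simp
      have Bm: "B j \<le> B j * real m" using mult_left_mono[OF m coeffs_nonneg(2)[of j]] by simp
      have "A j * real m \<le> A j * real m + B j" "A j * real m + B j \<le> (A j + B j) * real m"
        using Bm by (simp_all add: algebra_simps)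
      hence "ln (A j * real m) \<le> ln (A j * real m + B j)" "ln (A j * real m + B j) \<le> ln ((A j + B j) * real m)"
        using pos coeffs_nonneg(2)[of j] by (intro ln_le_cancel_iff[THEN iffD2]; linarith)+
      moreover have "ln (A j * real m) = ln (A j) + ln (real m)" "ln ((A j + B j) * real m) = ln (A j + B j) + ln (real m)"
        using A m coeffs_add_pos[of j] by (intro ln_mult_pos; simp)+
      ultimately show ?thesis using False by (simp add: K_def d_def)
    qed (auto simp: K_def d_def)
    from norm_form_kernel_ge[OF m this, of s]
    show "c * real m powr (- Re (sum_except k s)) \<le> norm (form_kernel A B s (real m) 1)"
      unfolding d c_def .
  qed (simp add: c_def)
  hence "(\<lambda>m::nat. (1 / c) * (c * real m powr (- Re (sum_except k s)))) summable_on {1..}"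
    by (rule summable_on_cmult_right)
  hence "(\<lambda>m::nat. real m powr (- Re (sum_except k s))) summable_on {1..}" by (simp add: c_def)
  from summable_on_powr_nat_imp[OF this] show ?thesis by simp
qed

text \<open>In the cone m \<le> n < 2 m all forms are comparable to m. Each m contributes m terms
  there, which raises the threshold from 1 to 2.\<close>

lemma summable_imp_sum_all:
  assumes "(\<lambda>(m, n). norm (form_kernel A B s (real m) (real n))) summable_on ({1..} \<times> {1..})"
  shows "Re (sum_all s) > 2"
proof -
  define K where "K j = \<bar>ln (A j + B j)\<bar> + \<bar>ln (A j + 2 * B j)\<bar>" for j
  define c where "c = exp (- (\<Sum>j\<in>UNIV. \<bar>Re (s $ j)\<bar> * K j))"
  define D where "D m = {m..<2 * m}" for m :: nat
  have d: "(\<Sum>j\<in>UNIV. Re (s $ j) * 1) = Re (sum_all s)" by (simp add: sum_all_def)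
  have "(\<lambda>(m, n). norm (form_kernel A B s (real m) (real n))) summable_on (Sigma {1..} D)"
    by (rule summable_on_subset_banach[OF assms]) (auto simp: D_def)
  hence "(\<lambda>m. infsum (\<lambda>n. norm (form_kernel A B s (real m) (real n))) (D m)) summable_on {1..}"
    by (rule summable_on_Sigma_banach)
  hence "(\<lambda>m. \<Sum>n\<in>D m. norm (form_kernel A B s (real m) (real n))) summable_on {1..}"
    by (simp add: D_def)
  hence "(\<lambda>m::nat. c * real m powr (1 - Re (sum_all s))) summable_on {1..}"
  proof (rule summable_on_comparison_test)
    fix m :: nat assume "m \<in> {1..}"
    hence m: "real m \<ge> 1" by simp
    have "c * real m powr (1 - Re (sum_all s)) = c * (real m powr 1 * real m powr (- Re (sum_all s)))"
      unfolding powr_add[symmetric] by simp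
    also have "\<dots> = (\<Sum>n\<in>D m. c * real m powr (- Re (sum_all s)))"
      using m by (simp add: D_def)
    also have "\<dots> \<le> (\<Sum>n\<in>D m. norm (form_kernel A B s (real m) (real n)))"
    proof (rule sum_mono)
      fix n assume "n \<in> D m"
      hence n: "real n \<ge> real m" "real n \<le> 2 * real m" by (auto simp: D_def)
      have "\<bar>ln (A j * real m + B j * real n) - 1 * ln (real m)\<bar> \<le> K j" for j
      proof -
        have AB: "A j + 2 * B j > 0" using coeffs_add_pos[of j] coeffs_nonneg(2)[of j] by linarith
        have "(A j + B j) * real m \<le> A j * real m + B j * real n"
          "A j * real m + B j * real n \<le> (A j + 2 * B j) * real m"
          using mult_left_mono[OF n(1) coeffs_nonneg(2)[of j]] mult_left_mono[OF n(2) coeffs_nonneg(2)[of j]]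
          by (auto simp: algebra_simps)
        moreover have "(A j + B j) * real m > 0" "A j * real m + B j * real n > 0" "(A j + 2 * B j) * real m > 0"
          using form_pos[OF m, of "real n" j] m n(1) AB coeffs_add_pos[of j] by auto
        ultimately have "ln ((A j + B j) * real m) \<le> ln (A j * real m + B j * real n)"
          "ln (A j * real m + B j * real n) \<le> ln ((A j + 2 * B j) * real m)" by auto
        moreover have "ln ((A j + B j) * real m) = ln (A j + B j) + ln (real m)"
          "ln ((A j + 2 * B j) * real m) = ln (A j + 2 * B j) + ln (real m)"
          using m AB coeffs_add_pos[of j] by (intro ln_mult_pos; simp)+
        ultimately show ?thesis by (simp add: K_def)
      qed
      from norm_form_kernel_ge[OF m this, of s]
      show "c * real m powr (- Re (sum_all s)) \<le> norm (form_kernel A B s (real m) (real n))"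
        unfolding d c_def .
    qed
    finally show "c * real m powr (1 - Re (sum_all s)) \<le> (\<Sum>n\<in>D m. norm (form_kernel A B s (real m) (real n)))" .
  qed (simp add: c_def)
  hence "(\<lambda>m::nat. (1 / c) * (c * real m powr (1 - Re (sum_all s)))) summable_on {1..}"
    by (rule summable_on_cmult_right)
  hence "(\<lambda>m::nat. real m powr (1 - Re (sum_all s))) summable_on {1..}" by (simp add: c_def)
  from summable_on_powr_nat_imp[OF this] show ?thesis by simp
qed

text \<open>\<open>G2_abs_conv\<close> is given by summability and not by inequalities; this
  direction makes the continuation agree with the series at every point of absolute
  convergence.\<close>

lemma summable_imp_region:
  assumes "(\<lambda>(m, n). norm (form_kernel A B s (real m) (real n))) summable_on ({1..} \<times> {1..})"
  shows "s \<in> region i k 0 0 0"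
proof -
  interpret sw: linear_forms B A k i by (rule swapped)
  have "(\<lambda>(m, n). norm (form_kernel B A s (real m) (real n))) summable_on ({1..} \<times> {1..})"
    using summable_on_Times_swap[OF assms] by (simp add: form_kernel_swap[of B A])
  thus ?thesis
    using summable_imp_sum_except[OF assms] summable_imp_sum_all[OF assms] sw.summable_imp_sum_except
    by (simp add: region_def)
qed

lemma kernel_integral_Comb_Comb:
  assumes s: "s \<in> region i k 0 0 0"
    and summable: "(\<lambda>(m, n). norm (form_kernel A B s (real m) (real n))) summable_on ({1..} \<times> {1..})"
  shows "kernel_integral A B Comb Comb s = (\<Sum>\<^sub>\<infinity>(m, n)\<in>{1..} \<times> {1..}. form_kernel A B s (real m) (real n))"
proof -
  have int_comb: "(LINT x|wmeasure Comb. wfun Comb x *\<^sub>R f x) = infsetsum (\<lambda>m. f (real m)) {1..}"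
    if [measurable]: "f \<in> borel_measurable borel" for f :: "real \<Rightarrow> complex"
  proof -
    have "(LINT x|wmeasure Comb. wfun Comb x *\<^sub>R f x) =
        (LINT m|count_space {1::nat..}. wfun Comb (real m) *\<^sub>R f (real m))"
      unfolding wmeasure.simps by (subst integral_distr) auto
    also have "\<dots> = (LINT m|count_space {1::nat..}. f (real m))"
      by (rule Bochner_Integration.integral_cong) auto
    finally show ?thesis by (simp add: infsetsum_def)
  qed
  have abs: "Infinite_Set_Sum.abs_summable_on (\<lambda>(m, n). form_kernel A B s (real m) (real n)) ({1..} \<times> {1..})"
    using summable unfolding abs_summable_equivalent[symmetric] by (simp add: case_prod_beta')
  interpret sigma_finite_measure "wmeasure Comb" by (rule sigma_finite_wmeasure)
  have "kernel_integral A B Comb Comb s =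
      (LINT x|wmeasure Comb. wfun Comb x *\<^sub>R (LINT y|wmeasure Comb. wfun Comb y *\<^sub>R form_kernel A B s x y))"
    unfolding kernel_integral_eq_pair(2)[OF s] by (simp flip: integral_scaleR_right)
  also have "\<dots> = infsetsum (\<lambda>m. LINT y|wmeasure Comb. wfun Comb y *\<^sub>R form_kernel A B s (real m) y) {1..}"
    by (rule int_comb) measurable
  also have "\<dots> = infsetsum (\<lambda>m. infsetsum (\<lambda>n. form_kernel A B s (real m) (real n)) {1..}) {1..}"
    by (subst int_comb) auto
  also have "\<dots> = infsetsum (\<lambda>(m, n). form_kernel A B s (real m) (real n)) ({1..} \<times> {1..})"
    by (rule infsetsum_Times'[OF _ _ abs]) auto
  also have "\<dots> = infsum (\<lambda>(m, n). form_kernel A B s (real m) (real n)) ({1..} \<times> {1..})"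
    by (rule infsetsum_infsum[OF abs])
  finally show ?thesis .
qed

end

section \<open>The root system $G_2$\<close>

lemma exhaust_6: "(x :: 6) = 1 \<or> x = 2 \<or> x = 3 \<or> x = 4 \<or> x = 5 \<or> x = 6"
proof (induct x)
  case (of_int z)
  hence "z = 0 \<or> z = 1 \<or> z = 2 \<or> z = 3 \<or> z = 4 \<or> z = 5" by fastforce
  thus ?case by auto
qed

lemma UNIV_6: "UNIV = {1, 2, 3, 4, 5, 6 :: 6}"
  using exhaust_6 by auto

text \<open>Together with \<open>G2_B\<close>, the coefficients of m, n, m + n, m + 2n, m + 3n and
  2m + 3n in the order of the exponents; indices 1 and 2 are the pure variables.\<close>

definition G2_A :: "6 \<Rightarrow> real" where
  "G2_A j = (if j = 2 then 0 else if j = 6 then 2 else 1)"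

definition G2_B :: "6 \<Rightarrow> real" where
  "G2_B j = (if j = 1 then 0 else if j = 4 then 2 else if j = 5 \<or> j = 6 then 3 else 1)"

lemma linear_forms_G2: "linear_forms G2_A G2_B 1 2"
  by unfold_locales (auto simp: G2_A_def G2_B_def)

lemma sum_except_G2:
  "sum_except 2 s = s $ 1 + s $ 3 + s $ 4 + s $ 5 + (s :: complex ^ 6) $ 6"
  "sum_except 1 s = s $ 2 + s $ 3 + s $ 4 + s $ 5 + s $ 6"
  "sum_all s = s $ 1 + s $ 2 + s $ 3 + s $ 4 + s $ 5 + s $ 6"
proof -
  have "UNIV - {2 :: 6} = {1, 3, 4, 5, 6}" "UNIV - {1 :: 6} = {2, 3, 4, 5, 6}"
    unfolding UNIV_6 by auto
  thus "sum_except 2 s = s $ 1 + s $ 3 + s $ 4 + s $ 5 + s $ 6"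
    "sum_except 1 s = s $ 2 + s $ 3 + s $ 4 + s $ 5 + s $ 6"
    "sum_all s = s $ 1 + s $ 2 + s $ 3 + s $ 4 + s $ 5 + s $ 6"
    unfolding sum_except_def sum_all_def UNIV_6 by simp_all
qed

lemma G2_term_eq_form_kernel:
  assumes "m \<ge> 1" "n \<ge> 1"
  shows "G2_term s m n = form_kernel G2_A G2_B s (real m) (real n)"
proof -
  have pw: "of_nat l powr z = exp (z * complex_of_real (ln (real l)))" if "l \<ge> 1" for l z
    using that by (simp add: powr_def)
  have sum: "(\<Sum>j\<in>UNIV. s $ j * complex_of_real (ln (G2_A j * real m + G2_B j * real n))) =
    s $ 1 * ln (real m) + s $ 2 * ln (real n) + s $ 3 * ln (real (m + n)) + s $ 4 * ln (real (m + 2 * n)) +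
    s $ 5 * ln (real (m + 3 * n)) + s $ 6 * ln (real (2 * m + 3 * n))"
    unfolding UNIV_6 by (simp add: G2_A_def G2_B_def)
  have "G2_term s m n = 1 / exp (s $ 1 * ln (real m) + s $ 2 * ln (real n) + s $ 3 * ln (real (m + n)) +
    s $ 4 * ln (real (m + 2 * n)) + s $ 5 * ln (real (m + 3 * n)) + s $ 6 * ln (real (2 * m + 3 * n)))"
    unfolding G2_term_def exp_add using assms by (simp only: pw)
  also have "\<dots> = form_kernel G2_A G2_B s (real m) (real n)"
    unfolding form_kernel_def sum exp_minus by (simp only: inverse_eq_divide)
  finally show ?thesis .
qed

theorem theorem3p1:
  "\<exists>F :: complex ^ 6 \<Rightarrow> complex.
     mv_meromorphic_on F UNIV \<and>
     (\<forall>s\<in>G2_abs_conv. F s = zeta_G2 s) \<and>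
     mv_singularities F \<subseteq>
       (\<Union>l::nat. {s. s $ 1 + s $ 3 + s $ 4 + s $ 5 + s $ 6 = 1 - of_nat l}) \<union>
       (\<Union>l::nat. {s. s $ 2 + s $ 3 + s $ 4 + s $ 5 + s $ 6 = 1 - of_nat l}) \<union>
       {s. s $ 1 + s $ 2 + s $ 3 + s $ 4 + s $ 5 + s $ 6 = 2}"
proof -
  interpret G2: linear_forms G2_A G2_B 1 2 by (rule linear_forms_G2)
  obtain F where F: "mv_meromorphic_on F UNIV"
    "\<And>s. s \<in> region 1 2 0 0 0 \<Longrightarrow> F s = kernel_integral G2_A G2_B Comb Comb s"
    "mv_singularities F \<subseteq> polar_set 1 2 \<union> {s. sum_all s = 2}"
    by (rule G2.double_zeta_continuation, rule that)
  have "F s = zeta_G2 s" if "s \<in> G2_abs_conv" for s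
  proof -
    \<comment> \<open>The arbitrary f covers both the norms in the condition of convergence and the
      values in the series.\<close>
    have eq: "(case z of (m, n) \<Rightarrow> f (G2_term s m n)) =
        (case z of (m, n) \<Rightarrow> f (form_kernel G2_A G2_B s (real m) (real n)))"
      if "z \<in> {1..} \<times> {1..}" for z and f :: "complex \<Rightarrow> 'a"
      using that by (auto simp: G2_term_eq_form_kernel)
    have summable: "(\<lambda>(m, n). norm (form_kernel G2_A G2_B s (real m) (real n))) summable_on ({1..} \<times> {1..})"
      using that unfolding G2_abs_conv_def mem_Collect_eq
      by (rule summable_on_cong[THEN iffD1, rotated]) (rule eq)
    have "zeta_G2 s = (\<Sum>\<^sub>\<infinity>(m, n)\<in>{1..} \<times> {1..}. form_kernel G2_A G2_B s (real m) (real n))"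
      unfolding zeta_G2_def by (rule infsum_cong) (use eq[of _ "\<lambda>x. x"] in simp)
    thus ?thesis
      using F(2) G2.kernel_integral_Comb_Comb[OF _ summable] G2.summable_imp_region[OF summable] by simp
  qed
  moreover have "polar_set 1 2 \<subseteq>
       (\<Union>l::nat. {s :: complex ^ 6. s $ 1 + s $ 3 + s $ 4 + s $ 5 + s $ 6 = 1 - of_nat l}) \<union>
       (\<Union>l::nat. {s. s $ 2 + s $ 3 + s $ 4 + s $ 5 + s $ 6 = 1 - of_nat l})"
  proof
    fix s :: "complex ^ 6" assume "s \<in> polar_set 1 2"
    moreover have "\<exists>l. q = 1 - of_nat l" if "q - 1 \<in> \<int>\<^sub>\<le>\<^sub>0" for q :: complex
    proof -
      from that obtain l where "q - 1 = - of_nat l" by (elim nonpos_Ints_cases')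
      thus ?thesis by (intro exI[of _ l]) (simp add: algebra_simps)
    qed
    ultimately show "s \<in> (\<Union>l::nat. {s :: complex ^ 6. s $ 1 + s $ 3 + s $ 4 + s $ 5 + s $ 6 = 1 - of_nat l}) \<union>
       (\<Union>l::nat. {s. s $ 2 + s $ 3 + s $ 4 + s $ 5 + s $ 6 = 1 - of_nat l})"
      unfolding polar_set_def sum_except_G2 by blast
  qed
  ultimately show ?thesis
    using F(1,3) unfolding sum_except_G2(3) by (intro exI[of _ F]) blast
qed

end
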